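(* Let $\alpha>0$, let $I_\alpha(n):=\int_1^\infty(\log t)^ne^{-\alpha t}\,dt$ for $n>0$, and set $u:=W(n/\alpha)$. For each integer $R\ge1$, as $n\to\infty$, $$I_\alpha(n)=\sqrt{2\pi}\,\frac{u^{n+1}e^{u-n/u}}{\sqrt{(1+u)n}}\left(1+\sum_{r=1}^{R-1}\frac{a_r(u)}{n^r}+O\!\left(\frac{u^R}{n^R}\right)\right),$$ where the implied constant depends only on $R$ and $\alpha$. Also $a_r(u)\ll u^r\ll\log^r(n)$.
   Context: $W$ is the Lambert function, the inverse of $x\mapsto xe^x$ on $[0,\infty)$. Partial ordinary Bell polynomials are defined by $(p_1x+p_2x^2+\cdots)^j=\sum_{i\ge j}\hat B_{i,j}(p_1,p_2,\dots)x^i$. For $u>0$, $\ell_i(u):=\sum_{j=1}^i\hat B_{i,j}(1,-\tfrac12,\tfrac13,\dots)\frac{(-1)^{j+1}}{ju^j}$, and $$a_r(v):=\sum_{j=0}^{2r}\frac{(2j+2r-1)!!}{j!}\left(\frac{v^2}{v+1}\right)^{j+r}\hat B_{2r,j}(\ell_3(v),\ell_4(v),\dots),$$ with $(-1)!!=1$. *)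

theory Defs
  imports "HOL-Analysis.Analysis" "HOL-Library.Landau_Symbols"
    "HOL-Computational_Algebra.Formal_Power_Series"
begin

definition lambertW :: "real \<Rightarrow> real" where
  "lambertW = the_inv_into {0..} (\<lambda>x. x * exp x)"

text \<open>The sequence \<open>p\<close> is indexed from 1, so that \<open>p k\<close> stands for $p_k$ and \<open>p 0\<close> is ignored.\<close>

definition ord_bell :: "nat \<Rightarrow> nat \<Rightarrow> (nat \<Rightarrow> real) \<Rightarrow> real" where
  "ord_bell i j p = fps_nth (Abs_fps (\<lambda>k. if k = 0 then 0 else p k) ^ j) i"

definition ell :: "nat \<Rightarrow> real \<Rightarrow> real" where
  "ell i u = (\<Sum>j=1..i. ord_bell i j (\<lambda>k. (-1) ^ (k + 1) / real k) * ((-1) ^ (j + 1) / (real j * u ^ j)))"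

text \<open>The double factorial $(2m-1)!! = 1 \cdot 3 \cdots (2m-1)$; the empty product gives $(-1)!! = 1$.\<close>

definition odd_dfact :: "nat \<Rightarrow> nat" where
  "odd_dfact m = (\<Prod>i=1..m. 2 * i - 1)"

definition a_coeff :: "nat \<Rightarrow> real \<Rightarrow> real" where
  "a_coeff r v = (\<Sum>j=0..2*r. real (odd_dfact (j + r)) / fact j * (v\<^sup>2 / (v + 1)) ^ (j + r)
                       * ord_bell (2*r) j (\<lambda>k. ell (k + 2) v))"

definition log_exp_integral :: "real \<Rightarrow> real \<Rightarrow> real" where
  "log_exp_integral \<alpha> n = integral {1..} (\<lambda>t. ln t powr n * exp (- \<alpha> * t))"

end

theory Submission
  imports Defs "HOL-Probability.Sinc_Integral"
begin

text \<open>
  Since \<open>\<alpha> e\<^sup>u = n / u\<close>, the integrand is maximal at \<open>t = e\<^sup>u\<close>. Substituting \<open>t = e\<^sup>u (1 + s y)\<close> with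
  \<open>s\<^sup>2 = u\<^sup>2 / ((u + 1) n)\<close> turns the integral, up to the stated prefactor, into the integral over \<open>y\<close> of
  \<open>exp (- y\<^sup>2 / 2 + y\<^sup>2 Q (s y))\<close>, where \<open>Q\<close> depends on \<open>u\<close> only and has the Taylor coefficients
  \<open>u\<^sup>2 / (u + 1) \<cdot> ell (k + 2) u\<close>, which are bounded uniformly in \<open>u \<ge> 1\<close>. One may therefore treat \<open>u\<close> and
  \<open>s\<close> as independent parameters and apply Laplace's method uniformly in \<open>u\<close>: the integrand differs
  from a Gaussian times a polynomial by at most \<open>C s\<^bsup>2R\<^esup> (1 + \<bar>y\<bar>)\<^bsup>6R\<^esup> e\<^bsup>-c\<bar>y\<bar>\<^esup>\<close>, and the Gaussian moments
  give the coefficients. The tails are controlled uniformly in \<open>u\<close> because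
  \<open>u ln (1 + ln (1 + x) / u) \<le> ln (1 + x)\<close>.
\<close>

unbundle no vec_syntax
unbundle fps_syntax

section \<open>Uniform Taylor expansions\<close>

text \<open>Only a Taylor remainder that is uniform in the parameter is required, never convergence of
  the formal series; this makes products and powers of expansions elementary.\<close>

definition coeff_bounded :: "'p set \<Rightarrow> ('p \<Rightarrow> real fps) \<Rightarrow> bool" where
  "coeff_bounded S A \<longleftrightarrow> (\<forall>k. \<exists>C. \<forall>p\<in>S. \<bar>A p $ k\<bar> \<le> C)"

definition unif_expansion ::
  "'p set \<Rightarrow> real \<Rightarrow> nat \<Rightarrow> ('p \<Rightarrow> real \<Rightarrow> real) \<Rightarrow> ('p \<Rightarrow> real fps) \<Rightarrow> bool" where
  "unif_expansion S d K f A \<longleftrightarrow>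
     (\<exists>C\<ge>0. \<forall>p\<in>S. \<forall>x. \<bar>x\<bar> \<le> d \<longrightarrow> \<bar>f p x - (\<Sum>k<K. A p $ k * x ^ k)\<bar> \<le> C * \<bar>x\<bar> ^ K)"

lemma coeff_bounded_uniform:
  assumes "coeff_bounded S A"
  obtains C where "C \<ge> 0" "\<And>p k. p \<in> S \<Longrightarrow> k < K \<Longrightarrow> \<bar>A p $ k\<bar> \<le> C"
proof -
  obtain c where c: "\<And>k p. p \<in> S \<Longrightarrow> \<bar>A p $ k\<bar> \<le> c k"
    using assms unfolding coeff_bounded_def by metis
  show ?thesis
  proof (rule that[of "\<Sum>k<K. \<bar>c k\<bar>"])
    fix p k assume "p \<in> S" "k < K"
    have "\<bar>A p $ k\<bar> \<le> \<bar>c k\<bar>" using c[OF \<open>p \<in> S\<close>, of k] by linarith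
    also have "\<dots> \<le> (\<Sum>k<K. \<bar>c k\<bar>)" using \<open>k < K\<close> by (intro member_le_sum) auto
    finally show "\<bar>A p $ k\<bar> \<le> (\<Sum>k<K. \<bar>c k\<bar>)" .
  qed (simp add: sum_nonneg)
qed

lemma coeff_bounded_mult:
  assumes "coeff_bounded S A" "coeff_bounded S B"
  shows "coeff_bounded S (\<lambda>p. A p * B p)"
  unfolding coeff_bounded_def
proof
  fix k
  obtain C where C: "C \<ge> 0" "\<And>p i. p \<in> S \<Longrightarrow> i < Suc k \<Longrightarrow> \<bar>A p $ i\<bar> \<le> C"
    using coeff_bounded_uniform[OF assms(1)] by metis
  obtain D where D: "D \<ge> 0" "\<And>p i. p \<in> S \<Longrightarrow> i < Suc k \<Longrightarrow> \<bar>B p $ i\<bar> \<le> D"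
    using coeff_bounded_uniform[OF assms(2)] by metis
  show "\<exists>C. \<forall>p\<in>S. \<bar>(A p * B p) $ k\<bar> \<le> C"
  proof (intro exI ballI)
    fix p assume p: "p \<in> S"
    have "\<bar>(A p * B p) $ k\<bar> \<le> (\<Sum>i=0..k. \<bar>A p $ i * B p $ (k - i)\<bar>)"
      unfolding fps_mult_nth by (rule sum_abs)
    also have "\<dots> \<le> (\<Sum>i=0..k. C * D)"
      using C D p by (intro sum_mono) (auto simp: abs_mult intro!: mult_mono)
    finally show "\<bar>(A p * B p) $ k\<bar> \<le> (\<Sum>i=0..k. C * D)" .
  qed
qed

lemma coeff_bounded_power:
  assumes "coeff_bounded S A"
  shows "coeff_bounded S (\<lambda>p. A p ^ j)"
proof (induction j)
  case 0
  show ?case by (auto simp: coeff_bounded_def)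
next
  case (Suc j)
  then show ?case using coeff_bounded_mult[OF assms Suc] by simp
qed

text \<open>The product of the truncations runs over a square of indices, the Cauchy product over
  the triangle \<open>i + j < K\<close> inside it. Every leftover term has total degree at least
  \<open>K\<close>, so it belongs to the remainder.\<close>

lemma truncated_product_remainder:
  fixes a b :: "real fps"
  shows "(\<Sum>k<K. a $ k * x ^ k) * (\<Sum>k<K. b $ k * x ^ k) - (\<Sum>k<K. (a * b) $ k * x ^ k)
       = (\<Sum>(i,j)\<in>({..<K} \<times> {..<K}) - {(i,j). i + j < K}. a $ i * b $ j * x ^ (i + j))"
proof -
  have "(\<Sum>k<K. (a * b) $ k * x ^ k) = (\<Sum>k<K. \<Sum>i\<le>k. a $ i * b $ (k - i) * x ^ (i + (k - i)))"
    by (simp add: fps_mult_nth sum_distrib_right atLeast0AtMost)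
  also have "\<dots> = (\<Sum>(i,j)\<in>{(i,j). i + j < K}. a $ i * b $ j * x ^ (i + j))"
    by (subst sum.triangle_reindex) simp
  finally have 1: "(\<Sum>k<K. (a * b) $ k * x ^ k)
      = (\<Sum>(i,j)\<in>{(i,j). i + j < K}. a $ i * b $ j * x ^ (i + j))" .
  have 2: "(\<Sum>k<K. a $ k * x ^ k) * (\<Sum>k<K. b $ k * x ^ k)
      = (\<Sum>(i,j)\<in>{..<K} \<times> {..<K}. a $ i * b $ j * x ^ (i + j))"
    by (simp add: sum_product sum.cartesian_product power_add mult_ac)
  have "{(i,j). i + j < K} \<subseteq> {..<K} \<times> {..<K}" by auto
  then show ?thesis unfolding 1 2 by (subst sum_diff) (auto intro: finite_subset)
qed

lemma unif_expansion_bounded: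
  assumes "unif_expansion S d K f A" "coeff_bounded S A" "d \<le> 1"
  obtains C where "C \<ge> 0" "\<And>p x. p \<in> S \<Longrightarrow> \<bar>x\<bar> \<le> d \<Longrightarrow> \<bar>f p x\<bar> \<le> C"
proof -
  obtain C where C: "C \<ge> 0" "\<And>p i. p \<in> S \<Longrightarrow> i < K \<Longrightarrow> \<bar>A p $ i\<bar> \<le> C"
    using coeff_bounded_uniform[OF assms(2)] by metis
  obtain D where D: "D \<ge> 0" "\<And>p x. p \<in> S \<Longrightarrow> \<bar>x\<bar> \<le> d \<Longrightarrow>
      \<bar>f p x - (\<Sum>k<K. A p $ k * x ^ k)\<bar> \<le> D * \<bar>x\<bar> ^ K"
    using assms(1) unfolding unif_expansion_def by metis
  show ?thesis
  proof (rule that[of "real K * C + D"])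
    fix p x assume p: "p \<in> S" and x: "\<bar>x\<bar> \<le> d"
    have x1: "\<bar>x\<bar> ^ k \<le> 1" for k using x assms(3) by (intro power_le_one) auto
    have "\<bar>\<Sum>k<K. A p $ k * x ^ k\<bar> \<le> (\<Sum>k<K. \<bar>A p $ k * x ^ k\<bar>)" by (rule sum_abs)
    also have "\<dots> \<le> (\<Sum>k<K. C * 1)"
      using C p x1 by (intro sum_mono) (auto simp: abs_mult power_abs intro!: mult_mono simp del: mult_1_right)
    finally have "\<bar>\<Sum>k<K. A p $ k * x ^ k\<bar> \<le> real K * C" by simp
    moreover have "D * \<bar>x\<bar> ^ K \<le> D" using x1[of K] D(1) by (simp add: mult_left_le)
    ultimately show "\<bar>f p x\<bar> \<le> real K * C + D" using D(2)[OF p x] by linarith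
  qed (use C D in auto)
qed

lemma unif_expansion_mult:
  assumes f: "unif_expansion S d K f A" "coeff_bounded S A"
    and g: "unif_expansion S d K g B" "coeff_bounded S B" and d: "d \<le> 1"
  shows "unif_expansion S d K (\<lambda>p x. f p x * g p x) (\<lambda>p. A p * B p)"
proof -
  obtain C where C: "C \<ge> 0" "\<And>p i. p \<in> S \<Longrightarrow> i < K \<Longrightarrow> \<bar>A p $ i\<bar> \<le> C"
    using coeff_bounded_uniform[OF f(2)] by metis
  obtain D where D: "D \<ge> 0" "\<And>p i. p \<in> S \<Longrightarrow> i < K \<Longrightarrow> \<bar>B p $ i\<bar> \<le> D"
    using coeff_bounded_uniform[OF g(2)] by metis
  obtain C1 where C1: "C1 \<ge> 0" "\<And>p x. p \<in> S \<Longrightarrow> \<bar>x\<bar> \<le> d \<Longrightarrow>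
      \<bar>f p x - (\<Sum>k<K. A p $ k * x ^ k)\<bar> \<le> C1 * \<bar>x\<bar> ^ K"
    using f(1) unfolding unif_expansion_def by metis
  obtain D1 where D1: "D1 \<ge> 0" "\<And>p x. p \<in> S \<Longrightarrow> \<bar>x\<bar> \<le> d \<Longrightarrow>
      \<bar>g p x - (\<Sum>k<K. B p $ k * x ^ k)\<bar> \<le> D1 * \<bar>x\<bar> ^ K"
    using g(1) unfolding unif_expansion_def by metis
  obtain G where G: "G \<ge> 0" "\<And>p x. p \<in> S \<Longrightarrow> \<bar>x\<bar> \<le> d \<Longrightarrow> \<bar>g p x\<bar> \<le> G"
    using unif_expansion_bounded[OF g d] by metis
  define P where "P = ({..<K} \<times> {..<K}) - {(i,j). i + j < K}"
  have "\<bar>f p x * g p x - (\<Sum>k<K. (A p * B p) $ k * x ^ k)\<bar>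
      \<le> (C1 * G + real K * C * D1 + real (card P) * (C * D)) * \<bar>x\<bar> ^ K"
    if p: "p \<in> S" and x: "\<bar>x\<bar> \<le> d" for p x
  proof -
    let ?a = "\<Sum>k<K. A p $ k * x ^ k" and ?b = "\<Sum>k<K. B p $ k * x ^ k"
    have x1: "\<bar>x\<bar> ^ k \<le> 1" for k using x d by (intro power_le_one) auto
    have "\<bar>?a\<bar> \<le> (\<Sum>k<K. \<bar>A p $ k * x ^ k\<bar>)" by (rule sum_abs)
    also have "\<dots> \<le> (\<Sum>k<K. C * 1)"
      using C p x1 by (intro sum_mono) (auto simp: abs_mult power_abs intro!: mult_mono simp del: mult_1_right)
    finally have a: "\<bar>?a\<bar> \<le> real K * C" by simp
    have "\<bar>(f p x - ?a) * g p x\<bar> \<le> (C1 * \<bar>x\<bar> ^ K) * G"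
      unfolding abs_mult using C1 G p x by (intro mult_mono) auto
    moreover have "\<bar>?a * (g p x - ?b)\<bar> \<le> (real K * C) * (D1 * \<bar>x\<bar> ^ K)"
      unfolding abs_mult using a C D1 p x by (intro mult_mono) auto
    moreover have "\<bar>?a * ?b - (\<Sum>k<K. (A p * B p) $ k * x ^ k)\<bar> \<le> real (card P) * (C * D) * \<bar>x\<bar> ^ K"
    proof -
      have "\<bar>?a * ?b - (\<Sum>k<K. (A p * B p) $ k * x ^ k)\<bar>
          \<le> (\<Sum>(i,j)\<in>P. \<bar>A p $ i * B p $ j * x ^ (i + j)\<bar>)"
        unfolding truncated_product_remainder P_def by (rule order_trans[OF sum_abs]) (auto intro!: sum_mono)
      also have "\<dots> \<le> (\<Sum>(i,j)\<in>P. C * D * \<bar>x\<bar> ^ K)"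
      proof (intro sum_mono, clarify)
        fix i j assume ij: "(i, j) \<in> P"
        have "\<bar>x\<bar> ^ (i + j) \<le> \<bar>x\<bar> ^ K"
          using ij x d by (intro power_decreasing) (auto simp: P_def)
        then show "\<bar>A p $ i * B p $ j * x ^ (i + j)\<bar> \<le> C * D * \<bar>x\<bar> ^ K"
          unfolding abs_mult power_abs using C D p ij by (intro mult_mono) (auto simp: P_def)
      qed
      finally show ?thesis by (simp add: mult_ac case_prod_unfold)
    qed
    \<comment> \<open>Replace \<open>f\<close>, then \<open>g\<close>, by its truncation, and
      finally discard the excess degrees of the product.\<close>
    moreover have "f p x * g p x - (\<Sum>k<K. (A p * B p) $ k * x ^ k)
        = (f p x - ?a) * g p x + ?a * (g p x - ?b) + (?a * ?b - (\<Sum>k<K. (A p * B p) $ k * x ^ k))"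
      by (simp add: algebra_simps)
    ultimately have "\<bar>f p x * g p x - (\<Sum>k<K. (A p * B p) $ k * x ^ k)\<bar>
        \<le> (C1 * \<bar>x\<bar> ^ K) * G + (real K * C) * (D1 * \<bar>x\<bar> ^ K) + real (card P) * (C * D) * \<bar>x\<bar> ^ K"
      by linarith
    then show ?thesis by (simp add: algebra_simps)
  qed
  then show ?thesis unfolding unif_expansion_def
    using C C1 D D1 G by (intro exI[of _ "C1 * G + real K * C * D1 + real (card P) * (C * D)"]) auto
qed

lemma unif_expansion_power:
  assumes "unif_expansion S d K f A" "coeff_bounded S A" "d \<le> 1"
  shows "unif_expansion S d K (\<lambda>p x. f p x ^ j) (\<lambda>p. A p ^ j)"
proof (induction j)
  case 0
  \<comment> \<open>For \<open>K = 0\<close> the truncation is empty and the error is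
    \<open>1 = \<bar>x\<bar> ^ 0\<close>; otherwise the error vanishes. Hence the witness 1.\<close>
  have "(\<Sum>k<K. (1::real fps) $ k * x ^ k) = (if K = 0 then 0 else 1)" for x
    by (cases K) (simp_all add: sum.lessThan_Suc_shift del: sum.lessThan_Suc)
  then show ?case by (auto simp: unif_expansion_def intro!: exI[of _ 1])
next
  case (Suc j)
  show ?case using unif_expansion_mult[OF assms(1,2) Suc coeff_bounded_power[OF assms(2)] assms(3)] by simp
qed

text \<open>Without constant term, all retained powers and the remainder are at most
  \<open>\<bar>x\<bar>\<close>, as \<open>d \<le> 1\<close>. This makes
  \<open>y\<^sup>2 * Q p (s * y)\<close> of size \<open>s * \<bar>y\<bar> ^ 3\<close> in Laplace's
  method.\<close>

lemma unif_expansion_linear_bound: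
  assumes "unif_expansion S d K f A" "coeff_bounded S A" "d \<le> 1" "K \<ge> 1" "\<And>p. p \<in> S \<Longrightarrow> A p $ 0 = 0"
  obtains C where "C \<ge> 0" "\<And>p x. p \<in> S \<Longrightarrow> \<bar>x\<bar> \<le> d \<Longrightarrow> \<bar>f p x\<bar> \<le> C * \<bar>x\<bar>"
proof -
  obtain C where C: "C \<ge> 0" "\<And>p i. p \<in> S \<Longrightarrow> i < K \<Longrightarrow> \<bar>A p $ i\<bar> \<le> C"
    using coeff_bounded_uniform[OF assms(2)] by metis
  obtain D where D: "D \<ge> 0" "\<And>p x. p \<in> S \<Longrightarrow> \<bar>x\<bar> \<le> d \<Longrightarrow>
      \<bar>f p x - (\<Sum>k<K. A p $ k * x ^ k)\<bar> \<le> D * \<bar>x\<bar> ^ K"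
    using assms(1) unfolding unif_expansion_def by metis
  show ?thesis
  proof (rule that[of "real K * C + D"])
    fix p x assume p: "p \<in> S" and x: "\<bar>x\<bar> \<le> d"
    have x1: "\<bar>x\<bar> ^ k \<le> \<bar>x\<bar>" if "k \<ge> 1" for k
      using x assms(3) that power_decreasing[of 1 k "\<bar>x\<bar>"] by auto
    have "\<bar>\<Sum>k<K. A p $ k * x ^ k\<bar> \<le> (\<Sum>k<K. \<bar>A p $ k * x ^ k\<bar>)" by (rule sum_abs)
    also have "\<dots> \<le> (\<Sum>k<K. C * \<bar>x\<bar>)"
    proof (intro sum_mono)
      fix k assume "k \<in> {..<K}"
      then show "\<bar>A p $ k * x ^ k\<bar> \<le> C * \<bar>x\<bar>"
        using C p x1[of k] assms(5)[OF p]
        by (cases "k = 0") (auto simp: abs_mult power_abs intro!: mult_mono)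
    qed
    finally have "\<bar>\<Sum>k<K. A p $ k * x ^ k\<bar> \<le> real K * C * \<bar>x\<bar>" by simp
    moreover have "D * \<bar>x\<bar> ^ K \<le> D * \<bar>x\<bar>" using x1[of K] D(1) assms(4) by (simp add: mult_left_mono)
    ultimately show "\<bar>f p x\<bar> \<le> (real K * C + D) * \<bar>x\<bar>" using D(2)[OF p x] by (simp add: algebra_simps)
  qed (use C D in auto)
qed

section \<open>The uniform Laplace method\<close>

text \<open>This is the Lagrange remainder. The factor \<open>exp (max 0 z)\<close> instead of
  \<open>exp \<bar>z\<bar>\<close> matters: the perturbation of the exponent will be compared with
  the Gaussian only from above.\<close>

lemma exp_taylor_remainder:
  fixes z :: real
  shows "\<bar>exp z - (\<Sum>j<K. z ^ j / fact j)\<bar> \<le> \<bar>z\<bar> ^ K * exp (max 0 z)"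
proof -
  consider "K = 0" | "K > 0" "z = 0" | "K > 0" "z > 0" | "K > 0" "z < 0" by linarith
  then have "\<exists>t \<le> max 0 z. exp z = (\<Sum>j<K. z ^ j / fact j) + exp t / fact K * z ^ K"
  proof cases
    case 1
    then show ?thesis by (intro exI[of _ z]) auto
  next
    case 2
    then show ?thesis by (intro exI[of _ 0]) (cases K; simp add: sum.lessThan_Suc_shift del: sum.lessThan_Suc)
  next
    case 3
    then obtain t where t: "\<bar>t\<bar> < \<bar>z\<bar>" "exp z = (\<Sum>j<K. z ^ j / fact j) + exp t / fact K * z ^ K"
      using Maclaurin_exp_lt[of z K] by auto
    with 3 show ?thesis by (intro exI[of _ t]) auto
  next
    \<comment> \<open>\<open>Maclaurin_exp_lt\<close> would only give
      \<open>\<bar>t\<bar> < \<bar>z\<bar>\<close>, which allows a positive \<open>t\<close>; here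
      \<open>t < 0\<close> is needed.\<close>
    case 4
    obtain t where "t < 0" "exp z = (\<Sum>j<K. exp 0 / fact j * z ^ j) + exp t / fact K * z ^ K"
      using Maclaurin_minus[of z K "\<lambda>_. exp" exp] 4 by auto
    then show ?thesis by (intro exI[of _ t]) auto
  qed
  then obtain t where t: "t \<le> max 0 z" "exp z = (\<Sum>j<K. z ^ j / fact j) + exp t / fact K * z ^ K"
    by auto
  have "\<bar>exp z - (\<Sum>j<K. z ^ j / fact j)\<bar> = \<bar>z\<bar> ^ K * (exp t / fact K)"
    using t(2) by (simp add: abs_mult power_abs)
  also have "exp t / fact K \<le> exp (max 0 z) / 1"
    using t(1) by (intro frac_le) (auto simp: fact_ge_1)
  finally show ?thesis by (simp add: mult_left_mono)
qed

section \<open>Integrability and Gaussian moments\<close>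

lemma integrable_poly_exp_abs:
  fixes c :: real
  assumes c: "c > 0"
  shows "integrable lborel (\<lambda>y::real. (1 + \<bar>y\<bar>) ^ k * exp (- c * \<bar>y\<bar>))"
proof -
  \<comment> \<open>One term of the exponential series beats the polynomial weight with two powers
    to spare, which pay for \<open>1 + y\<^sup>2\<close>. The factor \<open>exp c\<close> in
    \<open>B\<close> arises because the series is used at
    \<open>c * (1 + \<bar>y\<bar>)\<close>.\<close>
  define m where "m = k + 2"
  define B where "B = fact m / c ^ m * exp c"
  have "integrable lborel (\<lambda>y::real. inverse (1 + y\<^sup>2))"
    using integrable_inverse_1_plus_square by (simp add: set_integrable_def)
  then have "integrable lborel (\<lambda>y::real. B * inverse (1 + y\<^sup>2))" by (rule integrable_mult_right)
  then show ?thesis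
  proof (rule Bochner_Integration.integrable_bound)
    show "AE y in lborel. norm ((1 + \<bar>y\<bar>) ^ k * exp (- c * \<bar>y\<bar>)) \<le> norm (B * inverse (1 + y\<^sup>2))"
    proof (rule AE_I2)
      fix y :: real
      have "(c * (1 + \<bar>y\<bar>)) ^ m / fact m \<le> exp (c * (1 + \<bar>y\<bar>))"
      proof -
        have "summable (\<lambda>n. (c * (1 + \<bar>y\<bar>)) ^ n /\<^sub>R fact n)" by (rule summable_exp_generic)
        then have "(\<Sum>n\<in>{m}. (c * (1 + \<bar>y\<bar>)) ^ n /\<^sub>R fact n) \<le> exp (c * (1 + \<bar>y\<bar>))"
          unfolding exp_def using c by (intro sum_le_suminf) auto
        then show ?thesis by (simp add: field_simps)
      qed
      moreover have "exp (c * (1 + \<bar>y\<bar>)) = exp c * exp (c * \<bar>y\<bar>)"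
        by (simp add: exp_add distrib_left)
      ultimately have "c ^ m * (1 + \<bar>y\<bar>) ^ m / fact m \<le> exp c * exp (c * \<bar>y\<bar>)"
        by (simp only: power_mult_distrib)
      then have *: "(1 + \<bar>y\<bar>) ^ m * exp (- c * \<bar>y\<bar>) \<le> B"
        using c by (simp add: B_def field_simps exp_minus)
      have "(1 + \<bar>y\<bar>) ^ k * exp (- c * \<bar>y\<bar>) * (1 + y\<^sup>2) \<le> (1 + \<bar>y\<bar>) ^ k * exp (- c * \<bar>y\<bar>) * (1 + \<bar>y\<bar>)\<^sup>2"
        by (intro mult_left_mono) (auto simp: power2_sum)
      also have "\<dots> = (1 + \<bar>y\<bar>) ^ m * exp (- c * \<bar>y\<bar>)" by (simp add: m_def power_add mult_ac power2_eq_square)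
      also note *
      finally have "(1 + \<bar>y\<bar>) ^ k * exp (- c * \<bar>y\<bar>) \<le> B * inverse (1 + y\<^sup>2)"
        by (simp add: field_simps add_pos_nonneg)
      then show "norm ((1 + \<bar>y\<bar>) ^ k * exp (- c * \<bar>y\<bar>)) \<le> norm (B * inverse (1 + y\<^sup>2))" by simp
    qed
  qed measurable
qed

text \<open>The right-hand side is the form of the even standard normal moments, so the double
  factorials arise as Gaussian moments.\<close>

lemma odd_dfact_eq: "real (odd_dfact m) = fact (2 * m) / (2 ^ m * fact m)"
proof (induction m)
  case 0
  then show ?case by (simp add: odd_dfact_def)
next
  case (Suc m)
  have "odd_dfact (Suc m) = odd_dfact m * (2 * m + 1)"
    by (simp add: odd_dfact_def)
  then have "real (odd_dfact (Suc m)) = real (odd_dfact m) * (2 * real m + 1)"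
    by (simp only: of_nat_mult of_nat_add of_nat_numeral of_nat_1)
  then have "real (odd_dfact (Suc m)) = fact (2 * m) / (2 ^ m * fact m) * (2 * real m + 1)"
    using Suc by simp
  also have "\<dots> = fact (2 * Suc m) / (2 ^ Suc m * fact (Suc m))"
    by (simp add: field_simps del: fact_Suc) (simp add: algebra_simps)
  finally show ?case .
qed

lemma has_bochner_integral_gaussian_moment:
  "has_bochner_integral lborel (\<lambda>y::real. exp (- y\<^sup>2 / 2) * y ^ k)
     (if even k then sqrt (2 * pi) * real (odd_dfact (k div 2)) else 0)"
proof -
  have *: "exp (- y\<^sup>2 / 2) * y ^ k = sqrt (2 * pi) * (std_normal_density y * y ^ k)" for y :: real
    by (simp add: std_normal_density_def)
  show ?thesis
  proof (cases "even k")
    case True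
    then obtain m where m: "k = 2 * m" by auto
    show ?thesis unfolding *
      using has_bochner_integral_mult_right[OF std_normal_moment_even[of m], of "sqrt (2 * pi)"]
      by (simp add: m odd_dfact_eq)
  next
    case False
    then obtain m where m: "k = 2 * m + 1" using oddE by blast
    show ?thesis unfolding *
      using has_bochner_integral_mult_right[OF std_normal_moment_odd[of m], of "sqrt (2 * pi)"]
      by (simp add: m)
  qed
qed

text \<open>The approximating integrand: with \<open>a\<close> the Taylor series of
  \<open>Q\<close>, the exponential of \<open>y\<^sup>2 * Q (s * y)\<close> is cut after
  \<open>K\<close> terms and each power of \<open>Q\<close> after \<open>K\<close>
  coefficients.\<close>

definition laplace_poly :: "nat \<Rightarrow> real fps \<Rightarrow> real \<Rightarrow> real \<Rightarrow> real" where
  "laplace_poly K a s y =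
     exp (- y\<^sup>2 / 2) * (\<Sum>j<K. y ^ (2 * j) / fact j * (\<Sum>i<K. (a ^ j) $ i * (s * y) ^ i))"

lemma sum_even_odd_lessThan:
  fixes f :: "nat \<Rightarrow> real"
  assumes "\<And>i. odd i \<Longrightarrow> f i = 0"
  shows "(\<Sum>i<2 * R. f i) = (\<Sum>r<R. f (2 * r))"
  using assms by (induction R) auto

text \<open>Odd moments vanish, and \<open>y ^ (2 * j + 2 * r)\<close> yields
  \<open>odd_dfact (j + r)\<close>. Since \<open>a\<close> has no constant term,
  \<open>a ^ j\<close> starts in degree \<open>j\<close>, which cuts the sum over \<open>j\<close>
  at \<open>2 * r\<close> exactly as in \<open>a_coeff\<close>.\<close>

lemma has_bochner_integral_laplace_poly:
  assumes a: "a $ 0 = 0"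
  shows "has_bochner_integral lborel (laplace_poly (2 * R) a s)
     (sqrt (2 * pi) * (\<Sum>r<R. s ^ (2 * r) *
        (\<Sum>j=0..2 * r. real (odd_dfact (j + r)) / fact j * (a ^ j) $ (2 * r))))"
proof -
  define g :: "nat \<Rightarrow> real" where
    "g k = (if even k then sqrt (2 * pi) * real (odd_dfact (k div 2)) else 0)" for k
  define w where "w j i = (a ^ j) $ i * s ^ i / fact j" for i j
  have 1: "laplace_poly (2 * R) a s =
      (\<lambda>y. \<Sum>j<2 * R. \<Sum>i<2 * R. w j i * (exp (- y\<^sup>2 / 2) * y ^ (2 * j + i)))"
    by (rule ext) (simp add: laplace_poly_def w_def sum_distrib_left power_mult_distrib power_add mult_ac)
  have 2: "has_bochner_integral lborel (laplace_poly (2 * R) a s)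
      (\<Sum>j<2 * R. \<Sum>i<2 * R. w j i * g (2 * j + i))"
    unfolding 1 g_def
    by (intro has_bochner_integral_sum has_bochner_integral_mult_right has_bochner_integral_gaussian_moment)
  have "(\<Sum>j<2 * R. \<Sum>i<2 * R. w j i * g (2 * j + i))
      = (\<Sum>j<2 * R. \<Sum>r<R. w j (2 * r) * g (2 * j + 2 * r))"
    by (rule sum.cong[OF refl], rule sum_even_odd_lessThan) (auto simp: g_def)
  also have "\<dots> = (\<Sum>r<R. \<Sum>j<2 * R. w j (2 * r) * g (2 * j + 2 * r))"
    by (rule sum.swap)
  also have "\<dots> = (\<Sum>r<R. \<Sum>j=0..2 * r. w j (2 * r) * g (2 * j + 2 * r))"
  proof (rule sum.cong[OF refl])
    fix r assume "r \<in> {..<R}"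
    then show "(\<Sum>j<2 * R. w j (2 * r) * g (2 * j + 2 * r)) = (\<Sum>j=0..2 * r. w j (2 * r) * g (2 * j + 2 * r))"
      using startsby_zero_power_prefix[OF a] by (intro sum.mono_neutral_right) (auto simp: w_def)
  qed
  also have "\<dots> = sqrt (2 * pi) * (\<Sum>r<R. s ^ (2 * r) *
        (\<Sum>j=0..2 * r. real (odd_dfact (j + r)) / fact j * (a ^ j) $ (2 * r)))"
    unfolding sum_distrib_left by (intro sum.cong refl) (simp add: w_def g_def algebra_simps)
  finally show ?thesis using 2 by simp
qed

section \<open>Pointwise error bounds and their integration\<close>

lemma gaussian_le_exp_abs:
  fixes y c :: real
  assumes "0 < c" "c \<le> 1"
  shows "exp (- y\<^sup>2 / 6) \<le> exp 2 * exp (- c * \<bar>y\<bar>)"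
proof -
  \<comment> \<open>Completing the square gives
    \<open>- y\<^sup>2 / 6 \<le> 3 * c\<^sup>2 / 2 - c * \<bar>y\<bar>\<close>, and
    \<open>3 * c\<^sup>2 / 2 \<le> 2\<close>.\<close>
  have "0 \<le> (\<bar>y\<bar> - 3 * c)\<^sup>2" by simp
  then have "6 * (c * \<bar>y\<bar>) \<le> y\<^sup>2 + 9 * c\<^sup>2" by (simp add: power2_eq_square algebra_simps)
  moreover have "c\<^sup>2 \<le> 1" using assms by (simp add: power_le_one)
  ultimately have "- y\<^sup>2 / 6 \<le> 2 - c * \<bar>y\<bar>" by (simp add: field_simps)
  then show ?thesis unfolding exp_add[symmetric] by simp
qed

text \<open>Two truncation errors add up: that of the exponential series and those of the powers of
  \<open>Q\<close>. The bound 1/3 leaves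
  \<open>- y\<^sup>2 / 2 + y\<^sup>2 / 3 = - y\<^sup>2 / 6\<close> in the exponent, and the linear
  bound on \<open>Q\<close> provides the factor \<open>s ^ K\<close>.\<close>

lemma laplace_pointwise_near:
  assumes K: "K \<ge> 1" and d: "0 < d" "d \<le> 1"
    and Q: "unif_expansion S d K Q A" and A: "coeff_bounded S A" "\<And>p. p \<in> S \<Longrightarrow> A p $ 0 = 0"
    and Q_le: "\<And>p x. p \<in> S \<Longrightarrow> \<bar>x\<bar> \<le> d \<Longrightarrow> Q p x \<le> 1 / 3"
  obtains C where "C \<ge> 0"
    "\<And>p s y. p \<in> S \<Longrightarrow> 0 < s \<Longrightarrow> \<bar>s * y\<bar> \<le> d \<Longrightarrow>
       \<bar>exp (- y\<^sup>2 / 2 + y\<^sup>2 * Q p (s * y)) - laplace_poly K (A p) s y\<bar>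
         \<le> C * s ^ K * (1 + \<bar>y\<bar>) ^ (3 * K) * exp (- y\<^sup>2 / 6)"
proof -
  obtain C0 where C0: "C0 \<ge> 0" "\<And>p x. p \<in> S \<Longrightarrow> \<bar>x\<bar> \<le> d \<Longrightarrow> \<bar>Q p x\<bar> \<le> C0 * \<bar>x\<bar>"
    using unif_expansion_linear_bound[OF Q A(1) d(2) K A(2)] by metis
  have "\<forall>j. \<exists>C\<ge>0. \<forall>p\<in>S. \<forall>x. \<bar>x\<bar> \<le> d \<longrightarrow>
      \<bar>Q p x ^ j - (\<Sum>k<K. (A p ^ j) $ k * x ^ k)\<bar> \<le> C * \<bar>x\<bar> ^ K"
    using unif_expansion_power[OF Q A(1) d(2)] unfolding unif_expansion_def by blast
  then obtain C1 where C1: "\<And>j. C1 j \<ge> 0" "\<And>j p x. p \<in> S \<Longrightarrow> \<bar>x\<bar> \<le> d \<Longrightarrow>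
      \<bar>Q p x ^ j - (\<Sum>k<K. (A p ^ j) $ k * x ^ k)\<bar> \<le> C1 j * \<bar>x\<bar> ^ K"
    by metis
  show ?thesis
  proof (rule that[of "C0 ^ K + (\<Sum>j<K. C1 j)"])
    show "0 \<le> C0 ^ K + (\<Sum>j<K. C1 j)" using C0 C1 by (simp add: sum_nonneg)
    fix p s y assume p: "p \<in> S" and s: "0 < s" and sy: "\<bar>s * y\<bar> \<le> d"
    let ?z = "y\<^sup>2 * Q p (s * y)" and ?Y = "(1 + \<bar>y\<bar>) ^ (3 * K)"
    \<comment> \<open>The degree \<open>3 * K\<close> comes from \<open>\<bar>?z\<bar> ^ K\<close>;
      the other error has degree \<open>2 * j + K\<close>, which is smaller for
      \<open>j < K\<close>.\<close>
    have ypow: "\<bar>y\<bar> ^ k \<le> ?Y" if "k \<le> 3 * K" for k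
    proof -
      have "\<bar>y\<bar> ^ k \<le> (1 + \<bar>y\<bar>) ^ k" by (intro power_mono) auto
      also have "\<dots> \<le> ?Y" using that by (intro power_increasing) auto
      finally show ?thesis .
    qed
    have z3: "?z \<le> y\<^sup>2 / 3"
      using mult_left_mono[OF Q_le[OF p sy], of "y\<^sup>2"] by simp
    have "\<bar>?z\<bar> \<le> \<bar>y\<bar> ^ 2 * (C0 * \<bar>s * y\<bar>)"
      using C0(2)[OF p sy] by (auto simp: abs_mult intro: mult_left_mono)
    also have "\<dots> = C0 * s * \<bar>y\<bar> ^ 3"
      using s by (simp add: abs_mult power2_eq_square power3_eq_cube mult_ac)
    finally have "\<bar>?z\<bar> ^ K \<le> (C0 * s * \<bar>y\<bar> ^ 3) ^ K" by (intro power_mono) auto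
    also have "\<dots> = C0 ^ K * s ^ K * \<bar>y\<bar> ^ (3 * K)"
      by (simp add: power_mult_distrib power_mult)
    also have "\<dots> \<le> C0 ^ K * s ^ K * ?Y" using ypow C0 s by (intro mult_left_mono) auto
    finally have zK: "\<bar>?z\<bar> ^ K \<le> C0 ^ K * s ^ K * ?Y" .
    have "\<bar>exp (- y\<^sup>2 / 2) * (exp ?z - (\<Sum>j<K. ?z ^ j / fact j))\<bar>
        = exp (- y\<^sup>2 / 2) * \<bar>exp ?z - (\<Sum>j<K. ?z ^ j / fact j)\<bar>" by (simp add: abs_mult)
    also have "\<dots> \<le> exp (- y\<^sup>2 / 2) * (\<bar>?z\<bar> ^ K * exp (max 0 ?z))"
      by (intro mult_left_mono exp_taylor_remainder) auto
    also have "\<dots> = \<bar>?z\<bar> ^ K * exp (- y\<^sup>2 / 2 + max 0 ?z)" by (simp only: exp_add mult_ac)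
    also have "\<dots> \<le> (C0 ^ K * s ^ K * ?Y) * exp (- y\<^sup>2 / 6)"
      using zK z3 C0 s by (intro mult_mono) (auto simp: max_def)
    finally have main1: "\<bar>exp (- y\<^sup>2 / 2) * (exp ?z - (\<Sum>j<K. ?z ^ j / fact j))\<bar>
        \<le> C0 ^ K * s ^ K * ?Y * exp (- y\<^sup>2 / 6)" .
    let ?r = "\<lambda>j. Q p (s * y) ^ j - (\<Sum>i<K. (A p ^ j) $ i * (s * y) ^ i)"
    have "\<bar>\<Sum>j<K. y ^ (2 * j) / fact j * ?r j\<bar> \<le> (\<Sum>j<K. \<bar>y ^ (2 * j) / fact j * ?r j\<bar>)"
      by (rule sum_abs)
    also have "\<dots> \<le> (\<Sum>j<K. C1 j * (s ^ K * ?Y))"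
    proof (intro sum_mono)
      fix j assume j: "j \<in> {..<K}"
      have "\<bar>y ^ (2 * j) / fact j * ?r j\<bar> = (\<bar>y\<bar> ^ (2 * j) / fact j) * \<bar>?r j\<bar>"
        by (simp add: abs_mult power_abs)
      also have "\<dots> \<le> (\<bar>y\<bar> ^ (2 * j) / 1) * (C1 j * \<bar>s * y\<bar> ^ K)"
        using C1(2)[OF p sy] by (intro mult_mono divide_left_mono) (auto simp: fact_ge_1)
      also have "\<dots> = C1 j * (s ^ K * \<bar>y\<bar> ^ (2 * j + K))"
        using s by (simp add: abs_mult power_mult_distrib power_add mult_ac)
      also have "\<dots> \<le> C1 j * (s ^ K * ?Y)"
        using ypow[of "2 * j + K"] j C1(1)[of j] s by (intro mult_left_mono) auto
      finally show "\<bar>y ^ (2 * j) / fact j * ?r j\<bar> \<le> C1 j * (s ^ K * ?Y)" .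
    qed
    finally have r: "\<bar>\<Sum>j<K. y ^ (2 * j) / fact j * ?r j\<bar> \<le> (\<Sum>j<K. C1 j) * s ^ K * ?Y"
      by (simp add: sum_distrib_right mult.assoc)
    have "\<bar>exp (- y\<^sup>2 / 2) * (\<Sum>j<K. y ^ (2 * j) / fact j * ?r j)\<bar>
        = \<bar>\<Sum>j<K. y ^ (2 * j) / fact j * ?r j\<bar> * exp (- y\<^sup>2 / 2)" by (simp add: abs_mult)
    also have "\<dots> \<le> ((\<Sum>j<K. C1 j) * s ^ K * ?Y) * exp (- y\<^sup>2 / 6)"
      using r s C1(1) by (intro mult_mono) (auto intro!: sum_nonneg mult_nonneg_nonneg)
    finally have main2: "\<bar>exp (- y\<^sup>2 / 2) * (\<Sum>j<K. y ^ (2 * j) / fact j * ?r j)\<bar>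
        \<le> (\<Sum>j<K. C1 j) * s ^ K * ?Y * exp (- y\<^sup>2 / 6)" .
    have "exp (- y\<^sup>2 / 2 + ?z) - laplace_poly K (A p) s y
        = exp (- y\<^sup>2 / 2) * (exp ?z - (\<Sum>j<K. ?z ^ j / fact j))
          + exp (- y\<^sup>2 / 2) * (\<Sum>j<K. y ^ (2 * j) / fact j * ?r j)"
      unfolding laplace_poly_def exp_add
      by (simp add: right_diff_distrib sum_subtractf power_mult_distrib power_mult[symmetric] mult_ac)
    then have "\<bar>exp (- y\<^sup>2 / 2 + ?z) - laplace_poly K (A p) s y\<bar>
        \<le> C0 ^ K * s ^ K * ?Y * exp (- y\<^sup>2 / 6) + (\<Sum>j<K. C1 j) * s ^ K * ?Y * exp (- y\<^sup>2 / 6)"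
      using main1 main2 by linarith
    also have "\<dots> = (C0 ^ K + (\<Sum>j<K. C1 j)) * s ^ K * ?Y * exp (- y\<^sup>2 / 6)"
      by (simp only: distrib_right)
    finally show "\<bar>exp (- y\<^sup>2 / 2 + ?z) - laplace_poly K (A p) s y\<bar>
        \<le> (C0 ^ K + (\<Sum>j<K. C1 j)) * s ^ K * ?Y * exp (- y\<^sup>2 / 6)" .
  qed
qed

text \<open>Away from the peak the polynomial need only be small. Since
  \<open>\<bar>s * y\<bar> / d > 1\<close>, each lower power of \<open>s * y\<close> can be raised
  to the \<open>K\<close>-th at the cost of a constant, which creates the factor
  \<open>s ^ K\<close>.\<close>

lemma laplace_poly_far:
  assumes d: "0 < d" "d \<le> 1" and A: "coeff_bounded S A"
  obtains C where "C \<ge> 0"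
    "\<And>p s y. p \<in> S \<Longrightarrow> 0 < s \<Longrightarrow> \<bar>s * y\<bar> > d \<Longrightarrow>
       \<bar>laplace_poly K (A p) s y\<bar> \<le> C * s ^ K * (1 + \<bar>y\<bar>) ^ (3 * K) * exp (- y\<^sup>2 / 6)"
proof -
  have "\<forall>j. \<exists>C\<ge>0. \<forall>p\<in>S. \<forall>k<K. \<bar>(A p ^ j) $ k\<bar> \<le> C"
    using coeff_bounded_uniform[OF coeff_bounded_power[OF A], of K] by metis
  then obtain C1 where C1: "\<And>j. C1 j \<ge> 0" "\<And>j p k. p \<in> S \<Longrightarrow> k < K \<Longrightarrow> \<bar>(A p ^ j) $ k\<bar> \<le> C1 j"
    by metis
  show ?thesis
  proof (rule that[of "(\<Sum>j<K. C1 j) * (real K / d ^ K)"])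
    show "0 \<le> (\<Sum>j<K. C1 j) * (real K / d ^ K)" using d C1 by (simp add: sum_nonneg)
    fix p s y assume p: "p \<in> S" and s: "0 < s" and sy: "\<bar>s * y\<bar> > d"
    let ?Y = "(1 + \<bar>y\<bar>) ^ (3 * K)"
    have ypow: "\<bar>y\<bar> ^ k \<le> ?Y" if "k \<le> 3 * K" for k
    proof -
      have "\<bar>y\<bar> ^ k \<le> (1 + \<bar>y\<bar>) ^ k" by (intro power_mono) auto
      also have "\<dots> \<le> ?Y" using that by (intro power_increasing) auto
      finally show ?thesis .
    qed
    have xpow: "\<bar>s * y\<bar> ^ i \<le> \<bar>s * y\<bar> ^ K / d ^ K" if "i < K" for i
    proof -
      have "\<bar>s * y\<bar> ^ i * d ^ K \<le> \<bar>s * y\<bar> ^ i * d ^ (K - i)"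
        using d that by (intro mult_left_mono power_decreasing) auto
      also have "\<dots> \<le> \<bar>s * y\<bar> ^ i * \<bar>s * y\<bar> ^ (K - i)"
        using d sy by (intro mult_left_mono power_mono) auto
      also have "\<dots> = \<bar>s * y\<bar> ^ K" using that by (simp add: power_add[symmetric])
      finally show ?thesis using d by (simp add: field_simps)
    qed
    have inner: "\<bar>\<Sum>i<K. (A p ^ j) $ i * (s * y) ^ i\<bar> \<le> C1 j * (real K / d ^ K) * (s ^ K * \<bar>y\<bar> ^ K)" for j
    proof -
      have "\<bar>\<Sum>i<K. (A p ^ j) $ i * (s * y) ^ i\<bar> \<le> (\<Sum>i<K. \<bar>(A p ^ j) $ i * (s * y) ^ i\<bar>)"
        by (rule sum_abs)
      also have "\<dots> \<le> (\<Sum>i<K. C1 j * (\<bar>s * y\<bar> ^ K / d ^ K))"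
        unfolding abs_mult[of "_ $ _"] power_abs using C1 p xpow by (intro sum_mono mult_mono) auto
      also have "\<dots> = C1 j * (real K / d ^ K) * (s ^ K * \<bar>y\<bar> ^ K)"
        using s by (simp add: abs_mult power_mult_distrib)
      finally show ?thesis .
    qed
    have "\<bar>\<Sum>j<K. y ^ (2 * j) / fact j * (\<Sum>i<K. (A p ^ j) $ i * (s * y) ^ i)\<bar>
        \<le> (\<Sum>j<K. \<bar>y ^ (2 * j) / fact j * (\<Sum>i<K. (A p ^ j) $ i * (s * y) ^ i)\<bar>)"
      by (rule sum_abs)
    also have "\<dots> \<le> (\<Sum>j<K. C1 j * ((real K / d ^ K) * s ^ K * ?Y))"
    proof (intro sum_mono)
      fix j assume j: "j \<in> {..<K}"
      have "\<bar>y ^ (2 * j) / fact j * (\<Sum>i<K. (A p ^ j) $ i * (s * y) ^ i)\<bar>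
          = (\<bar>y\<bar> ^ (2 * j) / fact j) * \<bar>\<Sum>i<K. (A p ^ j) $ i * (s * y) ^ i\<bar>"
        by (simp add: abs_mult power_abs)
      also have "\<dots> \<le> (\<bar>y\<bar> ^ (2 * j) / 1) * (C1 j * (real K / d ^ K) * (s ^ K * \<bar>y\<bar> ^ K))"
        using inner by (intro mult_mono divide_left_mono) (auto simp: fact_ge_1)
      also have "\<dots> = C1 j * ((real K / d ^ K) * s ^ K * \<bar>y\<bar> ^ (2 * j + K))"
        by (simp add: power_add mult_ac)
      also have "\<dots> \<le> C1 j * ((real K / d ^ K) * s ^ K * ?Y)"
        using ypow[of "2 * j + K"] j C1(1)[of j] s d by (intro mult_left_mono) auto
      finally show "\<bar>y ^ (2 * j) / fact j * (\<Sum>i<K. (A p ^ j) $ i * (s * y) ^ i)\<bar>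
          \<le> C1 j * ((real K / d ^ K) * s ^ K * ?Y)" .
    qed
    finally have *: "\<bar>\<Sum>j<K. y ^ (2 * j) / fact j * (\<Sum>i<K. (A p ^ j) $ i * (s * y) ^ i)\<bar>
        \<le> (\<Sum>j<K. C1 j) * (real K / d ^ K) * s ^ K * ?Y"
      by (simp only: sum_distrib_right mult.assoc)
    have "\<bar>laplace_poly K (A p) s y\<bar>
        = \<bar>\<Sum>j<K. y ^ (2 * j) / fact j * (\<Sum>i<K. (A p ^ j) $ i * (s * y) ^ i)\<bar> * exp (- y\<^sup>2 / 2)"
      by (simp add: laplace_poly_def abs_mult)
    also have "\<dots> \<le> ((\<Sum>j<K. C1 j) * (real K / d ^ K) * s ^ K * ?Y) * exp (- y\<^sup>2 / 6)"
      using * s d C1(1) by (intro mult_mono) (auto intro!: sum_nonneg mult_nonneg_nonneg divide_nonneg_nonneg)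
    finally show "\<bar>laplace_poly K (A p) s y\<bar>
        \<le> (\<Sum>j<K. C1 j) * (real K / d ^ K) * s ^ K * ?Y * exp (- y\<^sup>2 / 6)" .
  qed
qed

text \<open>The pointwise error is dominated by \<open>s ^ K\<close> times one integrable weight
  that depends on neither \<open>p\<close> nor \<open>s\<close>, so integration gives a constant
  uniform in both.\<close>

lemma uniform_laplace_expansion:
  fixes F :: "'p \<Rightarrow> real \<Rightarrow> real \<Rightarrow> real"
  assumes R: "R \<ge> 1" and d: "0 < d" "d \<le> 1" and c: "0 < c" "c \<le> 1"
    and Q: "unif_expansion S d (2 * R) Q A" and A: "coeff_bounded S A" "\<And>p. p \<in> S \<Longrightarrow> A p $ 0 = 0"
    and Q_le: "\<And>p x. p \<in> S \<Longrightarrow> \<bar>x\<bar> \<le> d \<Longrightarrow> Q p x \<le> 1 / 3"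
    and meas: "\<And>p s. p \<in> S \<Longrightarrow> 0 < s \<Longrightarrow> F p s \<in> borel_measurable borel"
    and near: "\<And>p s y. p \<in> S \<Longrightarrow> 0 < s \<Longrightarrow> s \<le> 1 \<Longrightarrow> \<bar>s * y\<bar> \<le> d \<Longrightarrow>
                 F p s y = exp (- y\<^sup>2 / 2 + y\<^sup>2 * Q p (s * y))"
    and far: "\<And>p s y. p \<in> S \<Longrightarrow> 0 < s \<Longrightarrow> s \<le> 1 \<Longrightarrow> \<bar>s * y\<bar> > d \<Longrightarrow> \<bar>F p s y\<bar> \<le> exp (- c * \<bar>y\<bar>)"
  obtains C where "C \<ge> 0"
    "\<And>p s. p \<in> S \<Longrightarrow> 0 < s \<Longrightarrow> s \<le> 1 \<Longrightarrow> integrable lborel (F p s)"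
    "\<And>p s. p \<in> S \<Longrightarrow> 0 < s \<Longrightarrow> s \<le> 1 \<Longrightarrow>
       \<bar>(\<integral>y. F p s y \<partial>lborel) - sqrt (2 * pi) * (\<Sum>r<R. s ^ (2 * r) *
          (\<Sum>j=0..2 * r. real (odd_dfact (j + r)) / fact j * (A p ^ j) $ (2 * r)))\<bar> \<le> C * s ^ (2 * R)"
proof -
  \<comment> \<open>Only even powers of \<open>s\<close> survive integration, so truncation at
    \<open>2 * R\<close> leaves \<open>R\<close> terms.\<close>
  define K where "K = 2 * R"
  have K: "K \<ge> 1" using R by (simp add: K_def)
  obtain C1 where C1: "C1 \<ge> 0" "\<And>p s y. p \<in> S \<Longrightarrow> 0 < s \<Longrightarrow> \<bar>s * y\<bar> \<le> d \<Longrightarrow>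
       \<bar>exp (- y\<^sup>2 / 2 + y\<^sup>2 * Q p (s * y)) - laplace_poly K (A p) s y\<bar>
         \<le> C1 * s ^ K * (1 + \<bar>y\<bar>) ^ (3 * K) * exp (- y\<^sup>2 / 6)"
    using laplace_pointwise_near[OF K d Q[folded K_def] A Q_le] by metis
  obtain C2 where C2: "C2 \<ge> 0" "\<And>p s y. p \<in> S \<Longrightarrow> 0 < s \<Longrightarrow> \<bar>s * y\<bar> > d \<Longrightarrow>
       \<bar>laplace_poly K (A p) s y\<bar> \<le> C2 * s ^ K * (1 + \<bar>y\<bar>) ^ (3 * K) * exp (- y\<^sup>2 / 6)"
    using laplace_poly_far[OF d A(1), of K] by metis
  \<comment> \<open>\<open>C1\<close> covers the near error and \<open>C2\<close> the far
    polynomial, with \<open>exp 2\<close> from trading the Gaussian for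
    \<open>exp (- c * \<bar>y\<bar>)\<close>; \<open>1 / d ^ K\<close> pays for \<open>F\<close>
    itself in the far region.\<close>
  define D where "D = (C1 + C2) * exp 2 + 1 / d ^ K"
  define W where "W y = (1 + \<bar>y\<bar>) ^ (3 * K) * exp (- c * \<bar>y\<bar>)" for y :: real
  have W0: "W y \<ge> 0" for y by (simp add: W_def)
  have W: "integrable lborel W" unfolding W_def by (rule integrable_poly_exp_abs[OF c(1)])
  have gauss: "B * s ^ K * (1 + \<bar>y\<bar>) ^ (3 * K) * exp (- y\<^sup>2 / 6) \<le> B * exp 2 * s ^ K * W y"
    if "B \<ge> 0" "s > 0" for B s y :: real
    using mult_left_mono[OF gaussian_le_exp_abs[OF c, of y], of "B * s ^ K * (1 + \<bar>y\<bar>) ^ (3 * K)"] that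
    by (simp add: W_def mult_ac)
  have pointwise: "\<bar>F p s y - laplace_poly K (A p) s y\<bar> \<le> D * s ^ K * W y"
    if p: "p \<in> S" and s: "0 < s" "s \<le> 1" for p s y
  proof (cases "\<bar>s * y\<bar> \<le> d")
    case True
    have "\<bar>F p s y - laplace_poly K (A p) s y\<bar> \<le> C1 * exp 2 * s ^ K * W y"
      unfolding near[OF p s True] using C1(2)[OF p s(1) True] gauss[OF C1(1) s(1), of y] by linarith
    also have "\<dots> \<le> D * s ^ K * W y"
      using s C2(1) W0 d by (intro mult_right_mono) (auto simp: D_def algebra_simps)
    finally show ?thesis .
  next
    case False
    \<comment> \<open>The decay of \<open>F\<close> carries no power of \<open>s\<close>; this
      factor, which is at least 1, introduces it.\<close>
    have "1 \<le> (\<bar>s * y\<bar> / d) ^ K" using False d by (intro one_le_power) auto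
    also have "\<dots> = s ^ K * \<bar>y\<bar> ^ K / d ^ K" using s by (simp add: abs_mult power_divide power_mult_distrib)
    also have "\<dots> \<le> s ^ K * (1 + \<bar>y\<bar>) ^ (3 * K) / d ^ K"
    proof -
      have "\<bar>y\<bar> ^ K \<le> (1 + \<bar>y\<bar>) ^ K" by (intro power_mono) auto
      also have "\<dots> \<le> (1 + \<bar>y\<bar>) ^ (3 * K)" by (intro power_increasing) auto
      finally show ?thesis using s d by (intro divide_right_mono mult_left_mono) auto
    qed
    finally have "1 * exp (- c * \<bar>y\<bar>) \<le> s ^ K * (1 + \<bar>y\<bar>) ^ (3 * K) / d ^ K * exp (- c * \<bar>y\<bar>)"
      by (intro mult_right_mono) auto
    then have "exp (- c * \<bar>y\<bar>) \<le> 1 / d ^ K * s ^ K * W y" by (simp add: W_def mult_ac)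
    then have "\<bar>F p s y - laplace_poly K (A p) s y\<bar> \<le> 1 / d ^ K * s ^ K * W y + C2 * exp 2 * s ^ K * W y"
      using far[OF p s, of y] C2(2)[OF p s(1), of y] gauss[OF C2(1) s(1), of y] False by linarith
    also have "\<dots> = (1 / d ^ K + C2 * exp 2) * s ^ K * W y" by (simp add: algebra_simps)
    also have "\<dots> \<le> D * s ^ K * W y"
      using s C1(1) W0 by (intro mult_right_mono) (auto simp: D_def algebra_simps)
    finally show ?thesis .
  qed
  have D0: "D \<ge> 0" using C1 C2 d by (simp add: D_def)
  show ?thesis
  proof (rule that[of "D * integral\<^sup>L lborel W"])
    show "0 \<le> D * integral\<^sup>L lborel W" using D0 W0 by (intro mult_nonneg_nonneg integral_nonneg) auto
    fix p s assume p: "p \<in> S" and s: "0 < s" "s \<le> (1::real)"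
    note P = has_bochner_integral_laplace_poly[OF A(2)[OF p], of R s, folded K_def]
    have Pint: "integrable lborel (laplace_poly K (A p) s)"
      using P by (rule integrable.intros)
    have DW: "integrable lborel (\<lambda>y. D * s ^ K * W y)" by (intro integrable_mult_right W)
    have diff: "integrable lborel (\<lambda>y. F p s y - laplace_poly K (A p) s y)"
      using DW
    proof (rule Bochner_Integration.integrable_bound)
      show "(\<lambda>y. F p s y - laplace_poly K (A p) s y) \<in> borel_measurable lborel"
        using meas[OF p s(1)] borel_measurable_integrable[OF Pint] by auto
      show "AE y in lborel. norm (F p s y - laplace_poly K (A p) s y) \<le> norm (D * s ^ K * W y)"
        using pointwise[OF p s] by (intro AE_I2) (auto intro: order_trans[OF _ abs_ge_self])
    qed
    show Fint: "integrable lborel (F p s)"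
      using Bochner_Integration.integrable_add[OF diff Pint] by simp
    have "\<bar>(\<integral>y. F p s y \<partial>lborel) - (\<integral>y. laplace_poly K (A p) s y \<partial>lborel)\<bar>
        = \<bar>\<integral>y. F p s y - laplace_poly K (A p) s y \<partial>lborel\<bar>"
      using Fint Pint by simp
    also have "\<dots> \<le> (\<integral>y. \<bar>F p s y - laplace_poly K (A p) s y\<bar> \<partial>lborel)"
      by (rule integral_abs_bound)
    also have "\<dots> \<le> (\<integral>y. D * s ^ K * W y \<partial>lborel)"
      using diff DW pointwise[OF p s] by (intro integral_mono integrable_abs)
    also have "\<dots> = D * integral\<^sup>L lborel W * s ^ (2 * R)" by (simp add: K_def)
    finally show "\<bar>(\<integral>y. F p s y \<partial>lborel) - sqrt (2 * pi) * (\<Sum>r<R. s ^ (2 * r) *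
          (\<Sum>j=0..2 * r. real (odd_dfact (j + r)) / fact j * (A p ^ j) $ (2 * r)))\<bar>
        \<le> D * integral\<^sup>L lborel W * s ^ (2 * R)"
      unfolding has_bochner_integral_integral_eq[OF P] .
  qed
qed

section \<open>The phase function\<close>

text \<open>The Taylor series of \<open>ln (1 + x)\<close>. It occurs twice in \<open>ell\<close>:
  as the argument of the Bell polynomials and through the outer weights
  \<open>(-1) ^ (j + 1) / j\<close>.\<close>

definition ln_fps :: "real fps" where
  "ln_fps = Abs_fps (\<lambda>k. if k = 0 then 0 else (-1) ^ (k + 1) / real k)"

lemma ln_fps_nth: "ln_fps $ k = (if k = 0 then 0 else (-1) ^ (k + 1) / real k)"
  by (simp add: ln_fps_def)

lemma abs_ln_fps_le: "\<bar>ln_fps $ k\<bar> \<le> 1"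
  by (simp add: ln_fps_nth field_simps)

text \<open>In this form \<open>ell i u\<close> is visibly the coefficient of degree
  \<open>i\<close> of the composition \<open>ln (1 + ln (1 + x) / u)\<close>.\<close>

lemma ell_eq: "ell i u = (\<Sum>j=1..i. (ln_fps ^ j) $ i * (ln_fps $ j / u ^ j))"
  unfolding ell_def ord_bell_def by (intro sum.cong refl) (simp add: ln_fps_def)

lemma ln_taylor_remainder:
  fixes z a :: real
  assumes z: "\<bar>z\<bar> \<le> a" and a: "a < 1"
  shows "\<bar>ln (1 + z) - (\<Sum>k<K. ln_fps $ k * z ^ k)\<bar> \<le> \<bar>z\<bar> ^ K / (1 - a)"
proof -
  let ?f = "\<lambda>k. ln_fps $ k * z ^ k"
  have z1: "\<bar>z\<bar> < 1" using z a by simp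
  have geo: "summable (\<lambda>k. \<bar>z\<bar> ^ k)" using z1 by (simp add: summable_geometric)
  have f_le: "norm (?f k) \<le> \<bar>z\<bar> ^ k" for k
    using abs_ln_fps_le[of k] by (simp add: abs_mult power_abs mult_left_le_one_le)
  have sf: "summable ?f" by (rule summable_comparison_test'[OF geo, of 0]) (use f_le in auto)
  have "ln (1 + z) = (\<Sum>n. (-1) ^ n * (1 / real (n + 1)) * z ^ Suc n)"
    using ln_series[of "1 + z"] z1 by (simp add: abs_less_iff)
  also have "\<dots> = (\<Sum>n. ?f (Suc n))" by (simp add: ln_fps_nth)
  also have "\<dots> = suminf ?f"
    using suminf_split_head[OF sf] by (simp add: ln_fps_nth)
  finally have "ln (1 + z) - (\<Sum>k<K. ?f k) = (\<Sum>n. ?f (n + K))"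
    using suminf_split_initial_segment[OF sf, of K] by simp
  also have "\<bar>\<dots>\<bar> \<le> (\<Sum>n. \<bar>z\<bar> ^ (n + K))"
  proof -
    have sg: "summable (\<lambda>n. \<bar>z\<bar> ^ (n + K))" using geo by (rule summable_ignore_initial_segment)
    have sn: "summable (\<lambda>n. norm (?f (n + K)))"
      by (rule summable_comparison_test'[OF sg, of 0]) (use f_le in auto)
    have "norm (\<Sum>n. ?f (n + K)) \<le> (\<Sum>n. norm (?f (n + K)))" by (rule summable_norm[OF sn])
    also have "\<dots> \<le> (\<Sum>n. \<bar>z\<bar> ^ (n + K))" by (intro suminf_le sn sg f_le)
    finally show ?thesis by simp
  qed
  also have "\<dots> = \<bar>z\<bar> ^ K / (1 - \<bar>z\<bar>)"
    using z1 suminf_mult2[OF geo, of "\<bar>z\<bar> ^ K"] by (simp add: power_add suminf_geometric)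
  also have "\<dots> \<le> \<bar>z\<bar> ^ K / (1 - a)" using z a by (intro divide_left_mono) auto
  finally show ?thesis .
qed

lemma unif_expansion_ln:
  "unif_expansion S (1 / 4) K (\<lambda>_ x. ln (1 + x)) (\<lambda>_. ln_fps)"
  unfolding unif_expansion_def
  using ln_taylor_remainder[of _ "1 / 4" K] by (intro exI[of _ "4 / 3"]) (auto simp: mult.commute)

lemma coeff_bounded_const: "coeff_bounded S (\<lambda>_. a)"
  by (auto simp: coeff_bounded_def)

text \<open>The prefactor grows like \<open>u\<close>, but \<open>ell\<close> contains only powers
  \<open>1 / u ^ j\<close> with \<open>j \<ge> 1\<close>. This is why the scaled coefficients stay
  bounded uniformly in \<open>u\<close>.\<close>

lemma scaled_ratio_bound:
  fixes u :: real
  assumes "u \<ge> 1" "j \<ge> 1"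
  shows "0 \<le> u\<^sup>2 / (u + 1) / u ^ j" "u\<^sup>2 / (u + 1) / u ^ j \<le> 1"
proof -
  have "u\<^sup>2 / (u + 1) \<le> u ^ 1" using assms by (simp add: field_simps power2_eq_square)
  also have "\<dots> \<le> u ^ j" using assms by (intro power_increasing) auto
  finally show "u\<^sup>2 / (u + 1) / u ^ j \<le> 1" using assms by (subst divide_le_eq_1_pos) auto
qed (use assms in simp)

lemma coeff_bounded_ell:
  "coeff_bounded {1..} (\<lambda>u. Abs_fps (\<lambda>k. u\<^sup>2 / (u + 1) * ell k u))"
  unfolding coeff_bounded_def
proof
  fix k
  show "\<exists>C. \<forall>u\<in>{1..}. \<bar>Abs_fps (\<lambda>k. u\<^sup>2 / (u + 1) * ell k u) $ k\<bar> \<le> C"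
  proof (intro exI ballI)
    fix u :: real assume u: "u \<in> {1..}"
    have "\<bar>u\<^sup>2 / (u + 1) * ell k u\<bar>
        = \<bar>\<Sum>j=1..k. (ln_fps ^ j) $ k * ln_fps $ j * (u\<^sup>2 / (u + 1) / u ^ j)\<bar>"
      unfolding ell_eq sum_distrib_left by (simp add: mult_ac)
    also have "\<dots> \<le> (\<Sum>j=1..k. \<bar>(ln_fps ^ j) $ k * ln_fps $ j * (u\<^sup>2 / (u + 1) / u ^ j)\<bar>)"
      by (rule sum_abs)
    also have "\<dots> \<le> (\<Sum>j=1..k. \<bar>(ln_fps ^ j) $ k * ln_fps $ j\<bar> * 1)"
      unfolding abs_mult[of "_ * _"]
    proof (intro sum_mono mult_left_mono)
      fix j assume "j \<in> {1..k}"
      then show "\<bar>u\<^sup>2 / (u + 1) / u ^ j\<bar> \<le> 1" using scaled_ratio_bound[of u j] u by simp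
    qed simp
    finally show "\<bar>Abs_fps (\<lambda>k. u\<^sup>2 / (u + 1) * ell k u) $ k\<bar> \<le> (\<Sum>j=1..k. \<bar>(ln_fps ^ j) $ k * ln_fps $ j\<bar> * 1)"
      by simp
  qed
qed

text \<open>The range \<open>1..k\<close> can be made independent of \<open>k\<close>, after which
  the sums are exchanged: \<open>j = 0\<close> contributes nothing as \<open>ln_fps\<close> has no
  constant term, and \<open>j > k\<close> nothing as \<open>ln_fps ^ j\<close> starts in degree
  \<open>j\<close>.\<close>

lemma sum_ell_eq:
  "(\<Sum>k<K. ell k u * x ^ k) = (\<Sum>j<K. ln_fps $ j / u ^ j * (\<Sum>k<K. (ln_fps ^ j) $ k * x ^ k))"
proof -
  have "ell k u = (\<Sum>j<K. (ln_fps ^ j) $ k * (ln_fps $ j / u ^ j))" if "k < K" for k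
    unfolding ell_eq
  proof (rule sum.mono_neutral_left)
    show "\<forall>j\<in>{..<K} - {1..k}. (ln_fps ^ j) $ k * (ln_fps $ j / u ^ j) = 0"
    proof
      fix j assume "j \<in> {..<K} - {1..k}"
      then have "j = 0 \<or> k < j" by auto
      then show "(ln_fps ^ j) $ k * (ln_fps $ j / u ^ j) = 0"
        using startsby_zero_power_prefix[of ln_fps j] by (auto simp: ln_fps_nth)
    qed
  qed (use that in auto)
  then have "(\<Sum>k<K. ell k u * x ^ k) = (\<Sum>k<K. \<Sum>j<K. ln_fps $ j / u ^ j * ((ln_fps ^ j) $ k * x ^ k))"
    by (intro sum.cong refl) (simp add: sum_distrib_left sum_distrib_right mult_ac)
  then show ?thesis by (subst (asm) sum.swap) (simp add: sum_distrib_left)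
qed

text \<open>The outer logarithm is truncated first, then each power of the inner one. Both errors
  must stay bounded after multiplication by a prefactor of size \<open>u\<close>.\<close>

lemma unif_expansion_ln_ln:
  assumes K: "K \<ge> 1"
  shows "unif_expansion {1..} (1 / 4) K (\<lambda>u x. u\<^sup>2 / (u + 1) * ln (1 + ln (1 + x) / u))
           (\<lambda>u. Abs_fps (\<lambda>k. u\<^sup>2 / (u + 1) * ell k u))"
proof -
  have "\<forall>j. \<exists>C\<ge>0. \<forall>x::real. \<bar>x\<bar> \<le> 1 / 4 \<longrightarrow>
      \<bar>ln (1 + x) ^ j - (\<Sum>k<K. (ln_fps ^ j) $ k * x ^ k)\<bar> \<le> C * \<bar>x\<bar> ^ K"
    using unif_expansion_power[OF unif_expansion_ln[of UNIV K] coeff_bounded_const]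
    unfolding unif_expansion_def by auto
  then obtain C where C: "\<And>j. C j \<ge> 0" "\<And>j x::real. \<bar>x\<bar> \<le> 1 / 4 \<Longrightarrow>
      \<bar>ln (1 + x) ^ j - (\<Sum>k<K. (ln_fps ^ j) $ k * x ^ k)\<bar> \<le> C j * \<bar>x\<bar> ^ K"
    by metis
  define D where "D = (4 / 3) ^ K * (3 / 2) + (\<Sum>j<K. C j)"
  have "\<bar>u\<^sup>2 / (u + 1) * ln (1 + ln (1 + x) / u) - (\<Sum>k<K. u\<^sup>2 / (u + 1) * ell k u * x ^ k)\<bar> \<le> D * \<bar>x\<bar> ^ K"
    if u: "u \<ge> 1" and x: "\<bar>x\<bar> \<le> 1 / 4" for u x :: real
  proof -
    define \<kappa> where "\<kappa> = u\<^sup>2 / (u + 1)"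
    define L where "L = ln (1 + x)"
    have \<kappa>: "\<kappa> \<ge> 0" using u by (simp add: \<kappa>_def)
    have L1: "\<bar>L\<bar> \<le> 4 / 3 * \<bar>x\<bar>" using ln_taylor_remainder[OF x, of 1] by (simp add: L_def ln_fps_nth)
    have "\<bar>L / u\<bar> \<le> \<bar>L\<bar>" using u by (simp add: divide_le_eq mult_left_le mult_le_cancel_left1)
    \<comment> \<open>\<open>4 / 3 * (1 / 4) = 1 / 3\<close>, so the outer series is used at radius
      1/3 and its remainder carries the factor 3/2.\<close>
    then have L3: "\<bar>L / u\<bar> \<le> 1 / 3" using L1 x by linarith
    have "\<bar>\<kappa> * (ln (1 + L / u) - (\<Sum>j<K. ln_fps $ j * (L / u) ^ j))\<bar> \<le> \<kappa> * (\<bar>L / u\<bar> ^ K / (1 - 1 / 3))"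
      using mult_left_mono[OF ln_taylor_remainder[OF L3, of K] \<kappa>] \<kappa> by (simp only: abs_mult abs_of_nonneg)
    also have "\<dots> = \<kappa> / u ^ K * (\<bar>L\<bar> ^ K * (3 / 2))" using u by (simp add: power_divide)
    also have "\<dots> \<le> 1 * ((4 / 3 * \<bar>x\<bar>) ^ K * (3 / 2))"
      using L1 scaled_ratio_bound[OF u K] by (intro mult_mono power_mono) (auto simp: \<kappa>_def)
    finally have 1: "\<bar>\<kappa> * (ln (1 + L / u) - (\<Sum>j<K. ln_fps $ j * (L / u) ^ j))\<bar>
        \<le> (4 / 3) ^ K * (3 / 2) * \<bar>x\<bar> ^ K" by (simp add: power_mult_distrib power_divide mult_ac)
    let ?r = "\<lambda>j. L ^ j - (\<Sum>k<K. (ln_fps ^ j) $ k * x ^ k)"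
    have "\<bar>\<Sum>j<K. ln_fps $ j * (\<kappa> / u ^ j) * ?r j\<bar> \<le> (\<Sum>j<K. \<bar>ln_fps $ j * (\<kappa> / u ^ j) * ?r j\<bar>)"
      by (rule sum_abs)
    also have "\<dots> \<le> (\<Sum>j<K. C j * \<bar>x\<bar> ^ K)"
    proof (intro sum_mono)
      fix j
      have "\<bar>ln_fps $ j * (\<kappa> / u ^ j)\<bar> \<le> 1"
      \<comment> \<open>For \<open>j = 0\<close> the prefactor is unbounded in \<open>u\<close>, but
        the coefficient is zero; for \<open>j \<ge> 1\<close> a factor \<open>1 / u\<close> absorbs
        it.\<close>
      proof (cases "j = 0")
        case False
        then have "\<bar>\<kappa> / u ^ j\<bar> \<le> 1" using scaled_ratio_bound[OF u, of j] by (simp only: \<kappa>_def abs_of_nonneg)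
        then show ?thesis unfolding abs_mult using abs_ln_fps_le[of j] by (intro mult_le_one) auto
      qed (simp add: ln_fps_nth)
      then have "\<bar>ln_fps $ j * (\<kappa> / u ^ j)\<bar> * \<bar>?r j\<bar> \<le> 1 * (C j * \<bar>x\<bar> ^ K)"
        using C(2)[OF x, of j] unfolding L_def by (intro mult_mono) auto
      then show "\<bar>ln_fps $ j * (\<kappa> / u ^ j) * ?r j\<bar> \<le> C j * \<bar>x\<bar> ^ K" by (simp only: abs_mult mult_1)
    qed
    finally have 2: "\<bar>\<Sum>j<K. ln_fps $ j * (\<kappa> / u ^ j) * ?r j\<bar> \<le> (\<Sum>j<K. C j) * \<bar>x\<bar> ^ K"
      by (simp add: sum_distrib_right)
    have "(\<Sum>k<K. \<kappa> * ell k u * x ^ k) = \<kappa> * (\<Sum>k<K. ell k u * x ^ k)"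
      by (simp add: sum_distrib_left mult.assoc)
    then have "\<kappa> * ln (1 + L / u) - (\<Sum>k<K. \<kappa> * ell k u * x ^ k)
        = \<kappa> * (ln (1 + L / u) - (\<Sum>j<K. ln_fps $ j * (L / u) ^ j))
          + (\<Sum>j<K. ln_fps $ j * (\<kappa> / u ^ j) * ?r j)"
      unfolding sum_ell_eq
      by (simp add: right_diff_distrib sum_subtractf sum_distrib_left[of \<kappa>] power_divide mult_ac)
    then show ?thesis using 1 2 unfolding \<kappa>_def[symmetric] L_def[symmetric] D_def distrib_right by linarith
  qed
  moreover have "D \<ge> 0" using C(1) by (simp add: D_def sum_nonneg add_nonneg_nonneg)
  ultimately show ?thesis unfolding unif_expansion_def by auto
qed

text \<open>The exponent of the integrand at \<open>t = e\<^sup>u (1 + x)\<close>, normalised to have second derivative \<open>-1\<close> at 0.\<close>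

definition phase :: "real \<Rightarrow> real \<Rightarrow> real" where
  "phase u x = u\<^sup>2 / (u + 1) * (ln (1 + ln (1 + x) / u) - x / u)"

text \<open>The coefficients of \<open>(phase u x + x\<^sup>2 / 2) / x\<^sup>2\<close>.\<close>

definition phase_fps :: "real \<Rightarrow> real fps" where
  "phase_fps u = Abs_fps (\<lambda>k. if k = 0 then 0 else u\<^sup>2 / (u + 1) * ell (k + 2) u)"

lemma coeff_bounded_phase_fps: "coeff_bounded {1..} phase_fps"
  unfolding coeff_bounded_def
proof
  fix k
  obtain C where C: "\<forall>u\<in>{1..}. \<bar>Abs_fps (\<lambda>k. u\<^sup>2 / (u + 1) * ell k u) $ (k + 2)\<bar> \<le> C"
    using coeff_bounded_ell unfolding coeff_bounded_def by blast
  then show "\<exists>C. \<forall>p\<in>{1..}. \<bar>phase_fps p $ k\<bar> \<le> C"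
    by (intro exI[of _ "max 0 C"]) (auto simp: phase_fps_def intro: max.coboundedI2)
qed

lemma ell_0: "ell 0 u = 0"
  by (simp add: ell_eq)

lemma ell_1: "ell (Suc 0) u = 1 / u"
  by (simp add: ell_eq ln_fps_nth)

lemma ell_2: "u > 0 \<Longrightarrow> ell (Suc (Suc 0)) u = - (u + 1) / (2 * u\<^sup>2)"
  by (simp add: ell_eq ln_fps_nth power2_eq_square fps_mult_nth numeral_2_eq_2 field_simps)

text \<open>The double logarithm is expanded two degrees further. Degree 0 is absent, degree 1
  cancels the linear term of \<open>phase\<close>, and degree 2 has coefficient
  \<open>- 1 / 2\<close> and cancels \<open>x\<^sup>2 / 2\<close>; division by
  \<open>x\<^sup>2\<close> then shifts the rest.\<close>

lemma unif_expansion_phase: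
  assumes K: "K \<ge> 1"
  shows "unif_expansion {1..} (1 / 4) K (\<lambda>u x. (phase u x + x\<^sup>2 / 2) / x\<^sup>2) phase_fps"
proof -
  obtain C where C: "C \<ge> 0" "\<And>u x::real. u \<ge> 1 \<Longrightarrow> \<bar>x\<bar> \<le> 1 / 4 \<Longrightarrow>
      \<bar>u\<^sup>2 / (u + 1) * ln (1 + ln (1 + x) / u) - (\<Sum>k<Suc (Suc K). u\<^sup>2 / (u + 1) * ell k u * x ^ k)\<bar>
        \<le> C * \<bar>x\<bar> ^ Suc (Suc K)"
    using unif_expansion_ln_ln[of "Suc (Suc K)"] unfolding unif_expansion_def fps_nth_Abs_fps by force
  have "\<bar>(phase u x + x\<^sup>2 / 2) / x\<^sup>2 - (\<Sum>k<K. phase_fps u $ k * x ^ k)\<bar> \<le> C * \<bar>x\<bar> ^ K"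
    if u: "u \<ge> 1" and x: "\<bar>x\<bar> \<le> 1 / 4" for u x :: real
  proof (cases "x = 0")
    case True
    \<comment> \<open>Division by zero gives the value 0 here, in agreement with the zero constant
      term of \<open>phase_fps\<close>.\<close>
    have "(\<Sum>k<K. phase_fps u $ k * 0 ^ k) = 0"
      by (intro sum.neutral) (auto simp: phase_fps_def power_0_left)
    with True C(1) show ?thesis by simp
  next
    case False
    define \<kappa> where "\<kappa> = u\<^sup>2 / (u + 1)"
    have e2: "\<kappa> * ell (Suc (Suc 0)) u = - 1 / 2"
      using u by (simp add: ell_2 \<kappa>_def divide_simps)
    have "(\<Sum>k<Suc (Suc K). \<kappa> * ell k u * x ^ k)
        = \<kappa> * (x / u) + (\<Sum>k<K. \<kappa> * ell (Suc (Suc k)) u * x ^ Suc (Suc k))"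
      by (simp add: sum.lessThan_Suc_shift ell_0 ell_1 del: sum.lessThan_Suc)
    also have "(\<Sum>k<K. \<kappa> * ell (Suc (Suc k)) u * x ^ Suc (Suc k))
        = (\<Sum>k<K. x\<^sup>2 * (phase_fps u $ k * x ^ k)) - x\<^sup>2 / 2"
    proof (cases K)
      case (Suc M)
      show ?thesis unfolding Suc sum.lessThan_Suc_shift
        using e2 by (simp add: phase_fps_def \<kappa>_def power2_eq_square mult_ac)
    qed (use K in simp)
    finally have eq: "\<kappa> * ln (1 + ln (1 + x) / u) - (\<Sum>k<Suc (Suc K). \<kappa> * ell k u * x ^ k)
        = phase u x + x\<^sup>2 / 2 - x\<^sup>2 * (\<Sum>k<K. phase_fps u $ k * x ^ k)"
      by (simp add: phase_def \<kappa>_def[symmetric] right_diff_distrib sum_distrib_left)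
    have "\<bar>(phase u x + x\<^sup>2 / 2) / x\<^sup>2 - (\<Sum>k<K. phase_fps u $ k * x ^ k)\<bar>
        = \<bar>phase u x + x\<^sup>2 / 2 - x\<^sup>2 * (\<Sum>k<K. phase_fps u $ k * x ^ k)\<bar> / x\<^sup>2"
      using False by (subst abs_div_pos) (auto simp: diff_divide_distrib)
    also have "\<dots> \<le> C * \<bar>x\<bar> ^ Suc (Suc K) / x\<^sup>2"
      using C(2)[OF u x] unfolding \<kappa>_def[symmetric] eq by (intro divide_right_mono) auto
    also have "\<dots> = C * \<bar>x\<bar> ^ K"
      using False by (simp add: power2_eq_square field_simps)
    finally show ?thesis .
  qed
  then show ?thesis unfolding unif_expansion_def using C(1) by auto
qed

section \<open>Upper bounds for the phase\<close>

lemma ln_one_plus_le_nonneg: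
  fixes x :: real
  assumes "x \<ge> 0"
  shows "ln (1 + x) - x \<le> - (x\<^sup>2 / (2 * (1 + x)))"
proof -
  \<comment> \<open>The correction is quadratic near 0 and linear at infinity, like
    \<open>x - ln (1 + x)\<close> itself, so it serves both near and far from the peak.\<close>
  let ?g = "\<lambda>x::real. ln (1 + x) - x + x\<^sup>2 / (2 * (1 + x))"
  have "?g x \<le> ?g 0"
  proof (rule DERIV_nonpos_imp_nonincreasing[OF assms])
    fix t :: real assume t: "0 \<le> t" "t \<le> x"
    have "(?g has_real_derivative (1 / (1 + t) - 1 + (2 * t * (2 * (1 + t)) - t\<^sup>2 * 2) / (2 * (1 + t))\<^sup>2)) (at t)"
      using t by (auto intro!: derivative_eq_intros simp: power2_eq_square)
    moreover have "1 / (1 + t) - 1 + (2 * t * (2 * (1 + t)) - t\<^sup>2 * 2) / (2 * (1 + t))\<^sup>2 = - (t\<^sup>2 / (2 * (1 + t)\<^sup>2))"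
      using t by (simp add: divide_simps) (simp add: power2_eq_square algebra_simps)
    ultimately show "\<exists>y. (?g has_real_derivative y) (at t) \<and> y \<le> 0"
      using t by (intro exI[of _ "- (t\<^sup>2 / (2 * (1 + t)\<^sup>2))"]) auto
  qed
  then show ?thesis by simp
qed

lemma ln_one_plus_le_nonpos:
  fixes x :: real
  assumes "-1 < x" "x \<le> 0"
  shows "ln (1 + x) - x \<le> - (x\<^sup>2 / 2)"
proof -
  let ?g = "\<lambda>x::real. ln (1 + x) - x + x\<^sup>2 / 2"
  have "?g x \<le> ?g 0"
  proof (rule DERIV_nonneg_imp_nondecreasing[OF assms(2)])
    fix t :: real assume t: "x \<le> t" "t \<le> 0"
    have "(?g has_real_derivative (1 / (1 + t) - 1 + t)) (at t)"
      using t assms by (auto intro!: derivative_eq_intros)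
    moreover have "1 / (1 + t) - 1 + t = t\<^sup>2 / (1 + t)"
      using t assms by (simp add: field_simps power2_eq_square)
    ultimately show "\<exists>y. (?g has_real_derivative y) (at t) \<and> 0 \<le> y"
      using t assms by (intro exI[of _ "t\<^sup>2 / (1 + t)"]) auto
  qed
  then show ?thesis by simp
qed

lemma ln_one_plus_le_near:
  fixes x :: real
  assumes "\<bar>x\<bar> \<le> 1 / 4"
  shows "ln (1 + x) - x \<le> - (x\<^sup>2 / 3)"
proof (cases "x \<ge> 0")
  case True
  have "x\<^sup>2 / 3 \<le> x\<^sup>2 / (2 * (1 + x))" using assms True by (intro divide_left_mono) auto
  then show ?thesis using ln_one_plus_le_nonneg[OF True] by linarith
next
  case False
  have "x\<^sup>2 / 3 \<le> x\<^sup>2 / 2" by simp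
  then show ?thesis using ln_one_plus_le_nonpos[of x] False assms by linarith
qed

lemma ln_one_plus_le_far:
  fixes x :: real
  assumes "-1 < x" "\<bar>x\<bar> > 1 / 4"
  shows "ln (1 + x) - x \<le> - (\<bar>x\<bar> / 10)"
proof (cases "x \<ge> 0")
  case True
  \<comment> \<open>The constant 1/10 is the value of \<open>x / (2 * (1 + x))\<close> at
    \<open>x = 1 / 4\<close>, and this quotient increases with \<open>x\<close>.\<close>
  have "0 \<le> x * (4 * x - 1)" using True assms by (intro mult_nonneg_nonneg) auto
  then have "x / 10 \<le> x\<^sup>2 / (2 * (1 + x))" using True by (simp add: field_simps power2_eq_square)
  then show ?thesis using ln_one_plus_le_nonneg[OF True] True by simp
next
  case False
  have "\<bar>x\<bar> * (1 / 4) \<le> \<bar>x\<bar> * \<bar>x\<bar>" using assms by (intro mult_left_mono) auto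
  then have "\<bar>x\<bar> / 10 \<le> x\<^sup>2 / 2" by (simp add: power2_eq_square)
  then show ?thesis using ln_one_plus_le_nonpos[of x] False assms by linarith
qed

text \<open>The inequality \<open>ln (1 + w) \<le> w\<close> with \<open>w = ln (1 + x) / u\<close>
  removes the outer logarithm and leaves \<open>ln (1 + x) - x\<close> with weight
  \<open>u / (u + 1) \<ge> 1 / 2\<close>. The lower bound on \<open>x\<close> ensures
  \<open>1 + w > 0\<close>.\<close>

lemma phase_le:
  assumes u: "u \<ge> 1" and x: "exp (- u) - 1 < x" and neg: "ln (1 + x) - x \<le> - b" and b: "b \<ge> 0"
  shows "phase u x \<le> - (b / 2)"
proof -
  have x1: "1 + x > exp (- u)" using x by simp
  then have "ln (1 + x) > - u" using ln_less_cancel_iff[of "exp (- u)" "1 + x"] less_trans[OF exp_gt_zero x1] by simp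
  then have "1 + ln (1 + x) / u > 0" using u by (simp add: field_simps)
  then have "ln (1 + ln (1 + x) / u) \<le> ln (1 + x) / u" using ln_add_one_self_le_self2 by simp
  then have "ln (1 + ln (1 + x) / u) - x / u \<le> (ln (1 + x) - x) / u" by (simp add: diff_divide_distrib)
  also have "\<dots> \<le> - b / u" using neg u by (intro divide_right_mono) auto
  finally have "phase u x \<le> u\<^sup>2 / (u + 1) * (- b / u)"
    unfolding phase_def using u by (intro mult_left_mono) auto
  also have "\<dots> = - (b * (u / (u + 1)))" using u by (simp add: power2_eq_square field_simps)
  also have "\<dots> \<le> - (b * (1 / 2))"
    using u b by (intro le_imp_neg_le mult_left_mono) (auto simp: field_simps)
  finally show ?thesis by simp
qed

text \<open>The integrand at \<open>t = exp u * (1 + s * y)\<close>, divided by its value at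
  \<open>y = 0\<close>; the condition says \<open>t > 1\<close>. The scale \<open>s\<close> is kept
  independent of \<open>u\<close> and is tied to \<open>n\<close> only later.\<close>

definition scaled_integrand :: "real \<Rightarrow> real \<Rightarrow> real \<Rightarrow> real" where
  "scaled_integrand u s y = (if exp (- u) - 1 < s * y then exp (phase u (s * y) / s\<^sup>2) else 0)"

text \<open>Hence the window \<open>\<bar>x\<bar> \<le> 1 / 4\<close> of the Taylor expansion lies
  inside the domain \<open>t > 1\<close> for every \<open>u \<ge> 1\<close>.\<close>

lemma exp_minus_one_less: "u \<ge> 1 \<Longrightarrow> exp (- u) - 1 < - 1 / (4::real)"
proof -
  assume u: "u \<ge> (1::real)"
  have "exp u \<ge> 2" using u exp_ge_add_one_self[of u] by linarith
  then show ?thesis by (simp add: exp_minus field_simps)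
qed

lemma scaled_integrand_expansion:
  assumes R: "R \<ge> 1"
  obtains C where "C \<ge> 0"
    "\<And>u s. u \<ge> 1 \<Longrightarrow> 0 < s \<Longrightarrow> s \<le> 1 \<Longrightarrow> integrable lborel (scaled_integrand u s)"
    "\<And>u s. u \<ge> 1 \<Longrightarrow> 0 < s \<Longrightarrow> s \<le> 1 \<Longrightarrow>
       \<bar>(\<integral>y. scaled_integrand u s y \<partial>lborel) - sqrt (2 * pi) * (\<Sum>r<R. s ^ (2 * r) *
          (\<Sum>j=0..2 * r. real (odd_dfact (j + r)) / fact j * (phase_fps u ^ j) $ (2 * r)))\<bar>
         \<le> C * s ^ (2 * R)"
proof -
  have K: "2 * R \<ge> 1" using R by simp
  \<comment> \<open>\<open>d = 1 / 4\<close> is the radius of the phase expansion;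
    \<open>c = 1 / 20\<close> is half the constant of \<open>ln_one_plus_le_far\<close>, the other
    half being lost in \<open>phase_le\<close>.\<close>
  note expansion = uniform_laplace_expansion[where F = scaled_integrand and d = "1 / 4" and c = "1 / 20",
      OF R _ _ _ _ unif_expansion_phase[OF K] coeff_bounded_phase_fps]
  have near_le: "phase u x \<le> - (x\<^sup>2 / 6)" if "u \<ge> 1" "\<bar>x\<bar> \<le> 1 / 4" for u x :: real
    using phase_le[OF that(1) _ ln_one_plus_le_near[OF that(2)]] exp_minus_one_less[OF that(1)] that by force
  show ?thesis
  proof (rule expansion)
    show "phase_fps u $ 0 = 0" for u by (simp add: phase_fps_def)
    \<comment> \<open>The bound is \<open>1 / 2 - 1 / 6\<close>, with 1/6 from
      \<open>near_le\<close>.\<close>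
    show "(phase u x + x\<^sup>2 / 2) / x\<^sup>2 \<le> 1 / 3" if "u \<in> {1..}" "\<bar>x\<bar> \<le> 1 / 4" for u x :: real
    proof (cases "x = 0")
      case False
      then show ?thesis using near_le[of u x] that by (simp add: field_simps)
    qed simp
    show "scaled_integrand u s \<in> borel_measurable borel" for u s
      unfolding scaled_integrand_def phase_def by measurable
    show "scaled_integrand u s y = exp (- y\<^sup>2 / 2 + y\<^sup>2 * ((phase u (s * y) + (s * y)\<^sup>2 / 2) / (s * y)\<^sup>2))"
      if "u \<in> {1..}" "0 < s" "\<bar>s * y\<bar> \<le> 1 / 4" for u s y
    proof -
      have "exp (- u) - 1 < s * y" using exp_minus_one_less[of u] that by auto
      moreover have "phase u (s * y) / s\<^sup>2 = - y\<^sup>2 / 2 + y\<^sup>2 * ((phase u (s * y) + (s * y)\<^sup>2 / 2) / (s * y)\<^sup>2)"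
      proof (cases "y = 0")
        case False
        then show ?thesis using that by (simp add: divide_simps)
      qed (simp add: phase_def)
      ultimately show ?thesis by (simp add: scaled_integrand_def)
    qed
    show "\<bar>scaled_integrand u s y\<bar> \<le> exp (- (1 / 20) * \<bar>y\<bar>)"
      if u: "u \<in> {1..}" and s: "0 < s" "s \<le> 1" and y: "\<bar>s * y\<bar> > 1 / 4" for u s y
    proof (cases "exp (- u) - 1 < s * y")
      case True
      have "- 1 < s * y" using True exp_gt_zero[of "- u"] by linarith
      then have "phase u (s * y) \<le> - ((\<bar>s * y\<bar> / 10) / 2)"
        using u y True by (intro phase_le ln_one_plus_le_far) auto
      then have "phase u (s * y) / s\<^sup>2 \<le> - ((\<bar>s * y\<bar> / 10) / 2) / s\<^sup>2"
        by (intro divide_right_mono) auto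
      also have "\<dots> = - (\<bar>y\<bar> / 20) / s" using s by (simp add: abs_mult power2_eq_square)
      also have "\<dots> \<le> - (\<bar>y\<bar> / 20)" using s by (simp add: field_simps mult_left_le_one_le)
      finally show ?thesis using True by (simp add: scaled_integrand_def)
    qed (simp add: scaled_integrand_def)
  qed (use that in auto)
qed

text \<open>The critical point equation \<open>\<alpha> * exp u = n / u\<close> turns the exponent,
  up to a constant, into \<open>n * (ln (1 + ln (1 + x) / u) - x / u)\<close>, and the choice of
  \<open>s\<close> makes this \<open>phase u x / s\<^sup>2\<close>.\<close>

lemma log_exp_integral_eq_scaled:
  assumes \<alpha>: "\<alpha> > 0" and u: "u > 0" and n: "n > 0" "u * exp u = n / \<alpha>"
    and s: "s > 0" "s\<^sup>2 = u\<^sup>2 / (u + 1) / n" and int: "integrable lborel (scaled_integrand u s)"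
  shows "log_exp_integral \<alpha> n
           = u powr n * exp (u - n / u) * s * (\<integral>y. scaled_integrand u s y \<partial>lborel)"
proof -
  define f where "f t = indicator {1..} t *\<^sub>R (ln t powr n * exp (- \<alpha> * t))" for t :: real
  define B where "B = u powr n * exp (- (n / u))"
  have \<alpha>_eq: "\<alpha> * exp u = n / u" using n u \<alpha> by (simp add: field_simps)
  have f_eq: "f (exp u + exp u * s * y) = B * scaled_integrand u s y" for y
  proof -
    define x where "x = s * y"
    have t: "exp u + exp u * s * y = exp u * (1 + x)" by (simp add: x_def algebra_simps)
    have ge: "exp u * (1 + x) \<ge> 1 \<longleftrightarrow> exp (- u) - 1 \<le> x"
      by (simp add: exp_minus field_simps)
    consider "x < exp (- u) - 1" | "x = exp (- u) - 1" | "x > exp (- u) - 1" by linarith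
    then show ?thesis
    proof cases
      case 1
      then show ?thesis using ge unfolding t by (simp add: f_def scaled_integrand_def x_def)
    next
      \<comment> \<open>This is the endpoint \<open>t = 1\<close>, where \<open>0 powr n = 0\<close>
        matches the strict inequality in \<open>scaled_integrand\<close>.\<close>
      case 2
      then have "exp u * (1 + x) = 1" by (simp add: exp_minus)
      then show ?thesis unfolding t using 2 by (simp add: f_def scaled_integrand_def x_def)
    next
      case 3
      then have x1: "1 + x > exp (- u)" by simp
      then have x0: "1 + x > 0" using less_trans[OF exp_gt_zero] by blast
      have "ln (1 + x) > - u" using x1 x0 ln_less_cancel_iff[of "exp (- u)" "1 + x"] by simp
      then have pos: "1 + ln (1 + x) / u > 0" using u by (simp add: field_simps)
      have "ln (exp u * (1 + x)) = u * (1 + ln (1 + x) / u)"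
        using x0 u ln_mult[of "exp u" "1 + x"] by (simp add: distrib_left[of u])
      then have "ln (exp u * (1 + x)) powr n = u powr n * exp (n * ln (1 + ln (1 + x) / u))"
        using u pos by (simp add: powr_mult) (simp add: powr_def)
      moreover have "\<alpha> * (exp u * (1 + x)) = n / u * (1 + x)"
        using \<alpha>_eq by (simp add: mult.assoc[symmetric])
      moreover have "phase u x / s\<^sup>2 = n * (ln (1 + ln (1 + x) / u) - x / u)"
        unfolding s(2) phase_def using u n by simp
      ultimately show ?thesis
        unfolding t using 3 ge
        by (simp add: f_def scaled_integrand_def x_def[symmetric] B_def exp_add[symmetric] mult_ac
             right_diff_distrib distrib_left add_divide_distrib exp_diff[symmetric])
    qed
  qed
  have c: "exp u * s \<noteq> 0" using s by simp
  \<comment> \<open>Integrability is first carried back through the affine map; it is what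
    identifies the gauge integral in \<open>log_exp_integral\<close> with a Lebesgue
    integral.\<close>
  have "integrable lborel (\<lambda>y. f (exp u + exp u * s * y))"
    unfolding f_eq by (intro integrable_mult_right int)
  then have fint: "integrable lborel f" using lborel_integrable_real_affine_iff[OF c] by blast
  have "log_exp_integral \<alpha> n = (\<integral>t. f t \<partial>lborel)"
    unfolding log_exp_integral_def f_def
    using set_borel_integral_eq_integral(2)[of "{1..}" "\<lambda>t. ln t powr n * exp (- \<alpha> * t)"] fint
    by (simp add: set_integrable_def set_lebesgue_integral_def f_def[abs_def])
  also have "\<dots> = \<bar>exp u * s\<bar> *\<^sub>R (\<integral>y. f (exp u + exp u * s * y) \<partial>lborel)"
    by (rule lborel_integral_real_affine[OF c])
  also have "\<dots> = exp u * s * (B * (\<integral>y. scaled_integrand u s y \<partial>lborel))"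
    unfolding f_eq using s by simp
  finally show ?thesis by (simp add: B_def exp_diff exp_minus field_simps)
qed

section \<open>The Lambert function and the coefficients\<close>

text \<open>Strict monotonicity of \<open>x * exp x\<close> and the intermediate value theorem on
  \<open>[0, x]\<close> show that \<open>the_inv_into\<close> is a genuine inverse at
  \<open>x\<close>.\<close>

lemma lambertW_works:
  assumes "x \<ge> 0"
  shows "lambertW x \<ge> 0" "lambertW x * exp (lambertW x) = x"
proof -
  have mono: "a * exp a < b * exp b" if "0 \<le> a" "a < b" for a b :: real
    using that by (intro mult_strict_mono) auto
  have inj: "inj_on (\<lambda>x::real. x * exp x) {0..}"
    by (rule linorder_inj_onI) (use mono in \<open>force+\<close>)
  have "\<exists>y\<ge>0. y \<le> x \<and> y * exp y = x"
  proof (rule IVT')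
    have "x * 1 \<le> x * exp x" using assms by (intro mult_left_mono) auto
    then show "x \<le> x * exp x" by simp
  qed (use assms in \<open>auto intro!: continuous_intros\<close>)
  then have mem: "x \<in> (\<lambda>x. x * exp x) ` {0..}" by force
  show "lambertW x * exp (lambertW x) = x"
    unfolding lambertW_def using f_the_inv_into_f[OF inj mem] .
  show "lambertW x \<ge> 0"
    unfolding lambertW_def using the_inv_into_into[OF inj mem, of "{0..}"] by simp
qed

lemma lambertW_pos:
  assumes "x > 0"
  shows "lambertW x > 0"
  using lambertW_works[of x] assms by (cases "lambertW x = 0") auto

lemma filterlim_lambertW: "filterlim lambertW at_top at_top"
  unfolding filterlim_at_top_gt[of _ _ 0]
proof (intro allI impI)
  fix Z :: real assume Z: "Z > 0"
  show "eventually (\<lambda>x. Z \<le> lambertW x) at_top"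
    using eventually_gt_at_top[of "Z * exp Z"]
  proof eventually_elim
    case (elim x)
    have x: "x \<ge> 0" using elim Z mult_pos_pos[OF Z exp_gt_zero[of Z]] by linarith
    show ?case
    proof (rule ccontr)
      assume "\<not> Z \<le> lambertW x"
      then have "lambertW x * exp (lambertW x) \<le> Z * exp Z"
        using lambertW_works(1)[OF x] by (intro mult_mono) auto
      then show False using lambertW_works(2)[OF x] elim by simp
    qed
  qed
qed

text \<open>The factor \<open>(v\<^sup>2 / (v + 1)) ^ j\<close> scales the series under the Bell
  polynomial and is absorbed into \<open>phase_fps v ^ j\<close>; what remains is the sum produced
  by Laplace's method.\<close>

lemma a_coeff_eq:
  "a_coeff r v = (v\<^sup>2 / (v + 1)) ^ r *
     (\<Sum>j=0..2 * r. real (odd_dfact (j + r)) / fact j * (phase_fps v ^ j) $ (2 * r))"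
proof -
  have "phase_fps v = fps_const (v\<^sup>2 / (v + 1)) * Abs_fps (\<lambda>k. if k = 0 then 0 else ell (k + 2) v)"
    by (rule fps_ext) (simp add: phase_fps_def)
  then have "(phase_fps v ^ j) $ i = (v\<^sup>2 / (v + 1)) ^ j * ord_bell i j (\<lambda>k. ell (k + 2) v)" for i j
    by (simp only: ord_bell_def power_mult_distrib fps_const_power fps_mult_left_const_nth)
  then show ?thesis
    unfolding a_coeff_def sum_distrib_left by (intro sum.cong refl) (simp add: power_add mult_ac)
qed

text \<open>The coefficients of \<open>phase_fps\<close> are bounded uniformly in \<open>v\<close>,
  so growth comes only from the outer power of \<open>v\<^sup>2 / (v + 1) \<le> v\<close>.\<close>

lemma a_coeff_bound:
  obtains C where "C \<ge> 0" "\<And>v. v \<ge> 1 \<Longrightarrow> \<bar>a_coeff r v\<bar> \<le> C * v ^ r"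
proof -
  have "\<forall>j. \<exists>C. \<forall>v\<ge>1. \<bar>(phase_fps v ^ j) $ (2 * r)\<bar> \<le> C"
    using coeff_bounded_power[OF coeff_bounded_phase_fps] unfolding coeff_bounded_def by (metis atLeast_iff)
  then obtain C where C: "\<And>j v. v \<ge> 1 \<Longrightarrow> \<bar>(phase_fps v ^ j) $ (2 * r)\<bar> \<le> C j" by metis
  define D where "D = (\<Sum>j=0..2 * r. real (odd_dfact (j + r)) / fact j * C j)"
  have C0: "C j \<ge> 0" for j using C[of 1 j] by linarith
  show ?thesis
  proof (rule that[of D])
    show "D \<ge> 0" unfolding D_def using C0 by (intro sum_nonneg) simp
    fix v :: real assume v: "v \<ge> 1"
    have "\<bar>\<Sum>j=0..2 * r. real (odd_dfact (j + r)) / fact j * (phase_fps v ^ j) $ (2 * r)\<bar>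
       \<le> (\<Sum>j=0..2 * r. \<bar>real (odd_dfact (j + r)) / fact j * (phase_fps v ^ j) $ (2 * r)\<bar>)"
      by (rule sum_abs)
    also have "\<dots> \<le> D"
      unfolding D_def abs_mult using C[OF v] by (intro sum_mono mult_mono) auto
    finally have 1: "\<bar>\<Sum>j=0..2 * r. real (odd_dfact (j + r)) / fact j * (phase_fps v ^ j) $ (2 * r)\<bar> \<le> D" .
    have "v\<^sup>2 / (v + 1) \<le> v" using v by (simp add: field_simps power2_eq_square)
    then have "\<bar>(v\<^sup>2 / (v + 1)) ^ r\<bar> \<le> v ^ r" using v by (simp add: power_mono)
    then have "\<bar>a_coeff r v\<bar> \<le> v ^ r * D"
      unfolding a_coeff_eq abs_mult using 1 v by (intro mult_mono) auto
    then show "\<bar>a_coeff r v\<bar> \<le> D * v ^ r" by (simp add: mult.commute)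
  qed
qed

lemma lambertW_le_ln:
  assumes "x > 0" "lambertW x \<ge> 1"
  shows "lambertW x \<le> ln x"
proof -
  have "1 * exp (lambertW x) \<le> lambertW x * exp (lambertW x)"
    using assms(2) by (intro mult_right_mono) auto
  then have "exp (lambertW x) \<le> x" using lambertW_works(2)[of x] assms by simp
  then show ?thesis using assms by (simp add: ln_ge_iff)
qed

lemma a_coeff_0: "a_coeff 0 v = 1"
  by (simp add: a_coeff_def odd_dfact_def ord_bell_def)

section \<open>Specialisation to the Lambert parameter\<close>

lemma filterlim_lambertW_divide:
  assumes "\<alpha> > 0"
  shows "filterlim (\<lambda>n. lambertW (n / \<alpha>)) at_top at_top"
proof -
  have "filterlim (\<lambda>n. inverse \<alpha> * n) at_top at_top"
    using assms by (intro filterlim_tendsto_pos_mult_at_top[OF tendsto_const] filterlim_ident) auto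
  then have "filterlim (\<lambda>n. n / \<alpha>) at_top at_top" by (simp add: divide_inverse mult.commute)
  then show ?thesis by (rule filterlim_compose[OF filterlim_lambertW])
qed

text \<open>Only here are the parameters coupled, by \<open>s = u / sqrt ((1 + u) * n)\<close>; the
  uniform expansion applies once \<open>u \<ge> 1\<close> and \<open>s \<le> 1\<close>.\<close>

lemma log_exp_integral_expansion:
  assumes \<alpha>: "\<alpha> > 0" and R: "R \<ge> 1"
  obtains C where
    "\<forall>\<^sub>F n in at_top. \<bar>log_exp_integral \<alpha> n /
        (sqrt (2 * pi) * (lambertW (n / \<alpha>) powr (n + 1) * exp (lambertW (n / \<alpha>) - n / lambertW (n / \<alpha>))
           / sqrt ((1 + lambertW (n / \<alpha>)) * n)))
        - (\<Sum>r<R. a_coeff r (lambertW (n / \<alpha>)) / n ^ r)\<bar> \<le> C * (lambertW (n / \<alpha>) ^ R / n ^ R)"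
proof -
  define T where "T u r = (\<Sum>j=0..2 * r. real (odd_dfact (j + r)) / fact j * (phase_fps u ^ j) $ (2 * r))" for u r
  obtain C where C: "C \<ge> 0"
    "\<And>u s. u \<ge> 1 \<Longrightarrow> 0 < s \<Longrightarrow> s \<le> 1 \<Longrightarrow> integrable lborel (scaled_integrand u s)"
    "\<And>u s. u \<ge> 1 \<Longrightarrow> 0 < s \<Longrightarrow> s \<le> 1 \<Longrightarrow>
       \<bar>(\<integral>y. scaled_integrand u s y \<partial>lborel) - sqrt (2 * pi) * (\<Sum>r<R. s ^ (2 * r) * T u r)\<bar>
         \<le> C * s ^ (2 * R)"
    unfolding T_def by (rule scaled_integrand_expansion[OF R]) blast
  have lim: "filterlim (\<lambda>n. lambertW (n / \<alpha>)) at_top at_top"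
    by (rule filterlim_lambertW_divide[OF \<alpha>])
  \<comment> \<open>The bound \<open>- ln \<alpha>\<close> gives
    \<open>\<alpha> * exp u \<ge> 1\<close>, that is \<open>n / u \<ge> 1\<close>, and hence
    \<open>s\<^sup>2 \<le> u / n \<le> 1\<close>.\<close>
  have ev: "\<forall>\<^sub>F n in at_top. max 1 (- ln \<alpha>) \<le> lambertW (n / \<alpha>)"
    using lim unfolding filterlim_at_top by blast
  show ?thesis
  proof (rule that[of "C / sqrt (2 * pi)"])
    show "\<forall>\<^sub>F n in at_top. \<bar>log_exp_integral \<alpha> n /
        (sqrt (2 * pi) * (lambertW (n / \<alpha>) powr (n + 1) * exp (lambertW (n / \<alpha>) - n / lambertW (n / \<alpha>))
           / sqrt ((1 + lambertW (n / \<alpha>)) * n)))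
        - (\<Sum>r<R. a_coeff r (lambertW (n / \<alpha>)) / n ^ r)\<bar>
        \<le> C / sqrt (2 * pi) * (lambertW (n / \<alpha>) ^ R / n ^ R)"
      using ev eventually_gt_at_top[of 0]
    proof eventually_elim
      case (elim n)
      define u where "u = lambertW (n / \<alpha>)"
      define s where "s = u / sqrt ((1 + u) * n)"
      have n: "n > 0" and u: "u \<ge> 1" "u \<ge> - ln \<alpha>" using elim by (auto simp: u_def)
      have W: "u * exp u = n / \<alpha>" using lambertW_works(2)[of "n / \<alpha>"] n \<alpha> by (simp add: u_def)
      have s: "s > 0" and s2: "s\<^sup>2 = u\<^sup>2 / (u + 1) / n"
        using u n by (simp_all add: s_def power_divide add.commute)
      have s_le: "s\<^sup>2 \<le> u / n"
        unfolding s2 using u n by (intro divide_right_mono) (auto simp: field_simps power2_eq_square)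
      have "exp (- ln \<alpha>) \<le> exp u" using u by simp
      then have "1 \<le> \<alpha> * exp u" using \<alpha> by (simp add: exp_minus field_simps)
      also have "\<dots> = n / u" using W \<alpha> u by (simp add: field_simps)
      finally have "u / n \<le> 1" using u n by (simp add: field_simps)
      then have s1: "s \<le> 1" using s_le s power2_le_imp_le[of s 1] by simp
      have s_pow: "s ^ (2 * r) * T u r = a_coeff r u / n ^ r" for r
        unfolding power_mult s2 a_coeff_eq T_def by (simp add: power_divide power_mult_distrib)
      define J where "J = (\<integral>y. scaled_integrand u s y \<partial>lborel)"
      have "log_exp_integral \<alpha> n = u powr n * exp (u - n / u) * s * J"
        unfolding J_def
        using u by (intro log_exp_integral_eq_scaled[OF \<alpha> _ n W s s2 C(2)[OF u(1) s s1]]) auto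
      \<comment> \<open>The factor \<open>s\<close> from the substitution supplies the extra power
        of \<open>u\<close> and the square root of the prefactor.\<close>
      also have "u powr n * exp (u - n / u) * s = u powr (n + 1) * exp (u - n / u) / sqrt ((1 + u) * n)"
        using u by (simp add: s_def powr_add)
      finally have "log_exp_integral \<alpha> n = u powr (n + 1) * exp (u - n / u) / sqrt ((1 + u) * n) * J" .
      moreover have "u powr (n + 1) * exp (u - n / u) / sqrt ((1 + u) * n) \<noteq> 0" using u n by simp
      ultimately have "log_exp_integral \<alpha> n /
          (sqrt (2 * pi) * (u powr (n + 1) * exp (u - n / u) / sqrt ((1 + u) * n))) = J / sqrt (2 * pi)"
        by (simp only: mult.commute[of _ J] nonzero_mult_divide_mult_cancel_right simp_thms)
      then have "\<bar>log_exp_integral \<alpha> n /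
          (sqrt (2 * pi) * (u powr (n + 1) * exp (u - n / u) / sqrt ((1 + u) * n)))
          - (\<Sum>r<R. a_coeff r u / n ^ r)\<bar> = \<bar>J - sqrt (2 * pi) * (\<Sum>r<R. a_coeff r u / n ^ r)\<bar> / sqrt (2 * pi)"
        by (subst abs_div_pos) (auto simp: diff_divide_distrib)
      also have "\<dots> \<le> C * s ^ (2 * R) / sqrt (2 * pi)"
        using C(3)[OF u(1) s s1] unfolding s_pow J_def by (intro divide_right_mono) auto
      also have "\<dots> = C / sqrt (2 * pi) * (s\<^sup>2) ^ R" by (simp add: power_mult)
      also have "\<dots> \<le> C / sqrt (2 * pi) * (u / n) ^ R"
        using C(1) s_le by (intro mult_left_mono power_mono) auto
      finally show ?case unfolding u_def by (simp add: power_divide)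
    qed
  qed
qed

theorem theorem4p1:
  fixes \<alpha> :: real and u :: "real \<Rightarrow> real"
  assumes "\<alpha> > 0"
    and "\<And>n. u n = lambertW (n / \<alpha>)"
  shows "(\<forall>R::nat. R \<ge> 1 \<longrightarrow>
      (\<exists>E :: real \<Rightarrow> real. E \<in> O[at_top](\<lambda>n. u n ^ R / n ^ R) \<and>
        (\<forall>n>0. log_exp_integral \<alpha> n =
          sqrt (2 * pi) * (u n powr (n + 1) * exp (u n - n / u n) / sqrt ((1 + u n) * n)) *
          (1 + (\<Sum>r=1..<R. a_coeff r (u n) / n ^ r) + E n)))) \<and>
    (\<forall>r::nat. (\<lambda>n. a_coeff r (u n)) \<in> O[at_top](\<lambda>n. u n ^ r) \<and>
             (\<lambda>n. u n ^ r) \<in> O[at_top](\<lambda>n. ln n ^ r))"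
proof (intro conjI allI impI)
  define P where "P n = sqrt (2 * pi) * (u n powr (n + 1) * exp (u n - n / u n) / sqrt ((1 + u n) * n))" for n
  have P: "P n \<noteq> 0" if "n > 0" for n
    using lambertW_pos[of "n / \<alpha>"] that assms by (auto simp: P_def)
  fix R :: nat assume R: "R \<ge> 1"
  \<comment> \<open>With the exact relative error as witness, the identity for all
    \<open>n > 0\<close> is algebra, and only the order of \<open>E\<close> is asymptotic.\<close>
  define E where "E n = log_exp_integral \<alpha> n / P n - (\<Sum>r<R. a_coeff r (u n) / n ^ r)" for n
  show "\<exists>E :: real \<Rightarrow> real. E \<in> O[at_top](\<lambda>n. u n ^ R / n ^ R) \<and>
      (\<forall>n>0. log_exp_integral \<alpha> n =
          sqrt (2 * pi) * (u n powr (n + 1) * exp (u n - n / u n) / sqrt ((1 + u n) * n)) *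
          (1 + (\<Sum>r=1..<R. a_coeff r (u n) / n ^ r) + E n))"
  proof (intro exI[of _ E] conjI allI impI)
    obtain C where C: "\<forall>\<^sub>F n in at_top. \<bar>E n\<bar> \<le> C * (u n ^ R / n ^ R)"
      by (rule log_exp_integral_expansion[OF assms(1) R]) (simp only: E_def P_def assms(2))
    show "E \<in> O[at_top](\<lambda>n. u n ^ R / n ^ R)"
    proof (rule bigoI[of _ "\<bar>C\<bar>"])
      show "\<forall>\<^sub>F n in at_top. norm (E n) \<le> \<bar>C\<bar> * norm (u n ^ R / n ^ R)"
        using C by eventually_elim (simp add: abs_mult[symmetric] del: abs_divide)
    qed
    fix n :: real assume n: "n > 0"
    have "{..<R} = insert 0 {1..<R}" using R by auto
    then have "(\<Sum>r<R. a_coeff r (u n) / n ^ r) = 1 + (\<Sum>r=1..<R. a_coeff r (u n) / n ^ r)"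
      by (simp add: a_coeff_0)
    then have "log_exp_integral \<alpha> n = P n * (1 + (\<Sum>r=1..<R. a_coeff r (u n) / n ^ r) + E n)"
      using P[OF n] by (simp add: E_def)
    then show "log_exp_integral \<alpha> n =
          sqrt (2 * pi) * (u n powr (n + 1) * exp (u n - n / u n) / sqrt ((1 + u n) * n)) *
          (1 + (\<Sum>r=1..<R. a_coeff r (u n) / n ^ r) + E n)" by (simp only: P_def)
  qed
next
  fix r :: nat
  have "filterlim u at_top at_top"
    unfolding assms(2) by (rule filterlim_lambertW_divide[OF assms(1)])
  then have u1: "\<forall>\<^sub>F n in at_top. 1 \<le> u n" unfolding filterlim_at_top by blast
  obtain C where C: "\<And>v. v \<ge> 1 \<Longrightarrow> \<bar>a_coeff r v\<bar> \<le> C * v ^ r"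
    using a_coeff_bound[of r] by metis
  show "(\<lambda>n. a_coeff r (u n)) \<in> O[at_top](\<lambda>n. u n ^ r)"
  proof (rule bigoI[of _ C])
    show "\<forall>\<^sub>F n in at_top. norm (a_coeff r (u n)) \<le> C * norm (u n ^ r)"
      using u1 by eventually_elim (use C in simp)
  qed
  have "u \<in> O[at_top](\<lambda>n. ln n)"
  proof (rule bigoI[of _ 2])
    \<comment> \<open>\<open>ln n \<ge> - ln \<alpha>\<close> gives
      \<open>ln (n / \<alpha>) \<le> 2 * ln n\<close>, whence the constant 2.\<close>
    have "\<forall>\<^sub>F n in at_top. ln n \<ge> max 0 (- ln \<alpha>)"
      using ln_at_top unfolding filterlim_at_top by blast
    then show "\<forall>\<^sub>F n in at_top. norm (u n) \<le> 2 * norm (ln n)"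
      using u1 eventually_gt_at_top[of 0]
    proof eventually_elim
      case (elim n)
      have "u n \<le> ln (n / \<alpha>)"
        using lambertW_le_ln[of "n / \<alpha>"] elim assms by simp
      then show ?case using elim assms(1) by (simp add: ln_div)
    qed
  qed
  then show "(\<lambda>n. u n ^ r) \<in> O[at_top](\<lambda>n. ln n ^ r)" by (rule landau_o.big_power)
qed

end
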